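(* Let $q\in M$ and let $p=\gamma(q)\in\mathbb{C}P^N$, where $\gamma$ is the $T_{\mathbb{C}}$-equivariant Kodaira embedding described in the context. Then the moment image of $T_{\mathbb{C}}\cdot q$ (with respect to the K\"ahler form $\omega$ on $M$) is identical with the moment image of $T_{\mathbb{C}}\cdot p$ (with respect to the K\"ahler form $\omega_{FS}$ on $\mathbb{C}P^N$); hence, in particular, it is a convex polytope.
   Context: $T=(S^1)^n$, $T_{\mathbb{C}}=(\mathbb{C}^* )^n$. $M$ is a compact K\"ahler manifold with a holomorphic action of $T_{\mathbb{C}}$, and its K\"ahler form $\omega$ is an integral form for which the action of $T$ is Hamiltonian. Then $[\omega]$ is the Chern class of a complex line bundle $\mathbb{L}$ on $M$, and by a theorem of Kodaira some high power $\mathbb{L}^k$ admits enough global holomorphic sections to embed $M$ in a projective space $\mathbb{C}P^N$; let $\gamma:M\to\mathbb{C}P^N$ be this embedding. The action of $T_{\mathbb{C}}$ on $M$ lifts to $\mathbb{L}$, hence to a linear action on the space of holomorphic sections of $\mathbb{L}^k$, so that $\gamma$ intertwines the action on $M$ with the action on $\mathbb{C}P^N$ induced by a linear action of $T_{\mathbb{C}}$ on $\mathbb{C}^{N+1}$ with weights $\beta_0,\dots,\beta_N$. $\omega_{FS}$ is the canonical K\"ahler form on $\mathbb{C}P^N$: on the complement of the hyperplane $z_0=0$ it equals $\sqrt{-1}\,\partial\bar\partial\rho$ with $\rho=\log\big((|z_0|^2+\dots+|z_N|^2)/|z_0|^2\big)$. One has $[\omega]=\gamma^*[\omega_{FS}]$,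 so there is a $T$-invariant function $H:M\to\mathbb{R}$ with $\omega=\gamma^*\omega_{FS}+\sqrt{-1}\,\partial\bar\partial H$. Moment maps on the orbits are those determined by these potentials. Write $p=[a_0,\dots,a_N]$ with $a_0=1$, $c_i=|a_i|^2$, $\alpha_i=\beta_i-\beta_0$, and use the coordinates $s=(s_1,\dots,s_n)\in\mathbb{R}^n$ with $e^{s_i}=|\zeta_i|^2$ for $\zeta\in T_{\mathbb{C}}$. The restriction of $\rho$ to $T_{\mathbb{C}}\cdot p$ is $F(s)=\log\big(c_1e^{\alpha_1(s)}+\dots+c_Ne^{\alpha_N(s)}+1\big)$, and the restriction of the moment map to $T_{\mathbb{C}}\cdot p$ is the Legendre transform $L_F:s\mapsto dF_s$. The restriction of $\omega$ to $T_{\mathbb{C}}\cdot q$ is $\sqrt{-1}\,\partial\bar\partial F_1$ with $F_1(s)=H(s)+F(s)$, where $H(s)$ is the restriction of $H$ to the orbit, and the restriction of the moment map to $T_{\mathbb{C}}\cdot q$ is $L_{F_1}:s\mapsto d(F_1)_s$. The moment image of an orbit is its image under the moment map.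
   Formalization: "It is a convex polytope" is stated as: the moment image of the orbit is the relative interior of a convex polytope (an open polytope); the image of a non-fixed orbit is not closed, e.g. the open interval (0,1) for the open orbit in CP^1. *)

theory Defs
  imports "HOL-Analysis.Analysis"
begin

section \<open>Smooth and holomorphic maps between open subsets of vector spaces\<close>

primrec Ck_on :: "nat \<Rightarrow> 'a::euclidean_space set \<Rightarrow> ('a \<Rightarrow> 'b::real_normed_vector) \<Rightarrow> bool" where
  "Ck_on 0 S f \<longleftrightarrow> continuous_on S f"
| "Ck_on (Suc k) S f \<longleftrightarrow>
     (\<forall>x\<in>S. f differentiable (at x)) \<and> (\<forall>v. Ck_on k S (\<lambda>x. frechet_derivative f (at x) v))"

definition smooth_on :: "'a::euclidean_space set \<Rightarrow> ('a \<Rightarrow> 'b::real_normed_vector) \<Rightarrow> bool" where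
  "smooth_on S f \<longleftrightarrow> (\<forall>k. Ck_on k S f)"

definition cholomorphic_on :: "(complex^'d::finite \<Rightarrow> complex^'e::finite) \<Rightarrow> (complex^'d) set \<Rightarrow> bool" where
  "cholomorphic_on f S \<longleftrightarrow>
     (\<forall>x\<in>S. \<exists>D. (f has_derivative D) (at x) \<and> (\<forall>c v. D (c *s v) = c *s D v))"

text \<open>The Wirtinger derivatives \<open>\<partial>f/\<partial>z\<^sub>j\<close> and \<open>\<partial>f/\<partial>\<close>(conjugate of \<open>z\<^sub>j\<close>).\<close>

definition wirtinger :: "'d::finite \<Rightarrow> (complex^'d \<Rightarrow> complex) \<Rightarrow> complex^'d \<Rightarrow> complex" where
  "wirtinger j f x =
     (frechet_derivative f (at x) (axis j 1) - \<i> * frechet_derivative f (at x) (axis j \<i>)) / 2"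

definition wirtinger_bar :: "'d::finite \<Rightarrow> (complex^'d \<Rightarrow> complex) \<Rightarrow> complex^'d \<Rightarrow> complex" where
  "wirtinger_bar j f x =
     (frechet_derivative f (at x) (axis j 1) + \<i> * frechet_derivative f (at x) (axis j \<i>)) / 2"

text \<open>The real (1,1)-form \<open>\<i> \<partial>\<partial>\<close>-bar \<open>f\<close> at \<open>x\<close>, evaluated on the tangent vectors \<open>u\<close> and \<open>v\<close>; the
  convention is that \<open>\<alpha> \<and> \<beta>\<close> takes the value \<open>\<alpha> u * \<beta> v - \<alpha> v * \<beta> u\<close>.  The sum is real, so \<open>Re\<close>
  only changes the type.\<close>

definition i_ddbar :: "(complex^'d::finite \<Rightarrow> real) \<Rightarrow> complex^'d \<Rightarrow> complex^'d \<Rightarrow> complex^'d \<Rightarrow> real" where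
  "i_ddbar f x u v =
     Re (\<i> * (\<Sum>j\<in>UNIV. \<Sum>k\<in>UNIV.
        wirtinger j (wirtinger_bar k (\<lambda>y. complex_of_real (f y))) x
          * (u $ j * cnj (v $ k) - v $ j * cnj (u $ k))))"


section \<open>Complex manifolds\<close>

text \<open>A chart is a domain together with a coordinate map (which is arbitrary off the domain).
  The inverse of a chart \<open>c\<close> is \<open>inv_into (fst c) (snd c)\<close>.\<close>

type_synonym ('a, 'd) chart = "'a set \<times> ('a \<Rightarrow> complex^'d)"

definition chart_inv :: "('a, 'd::finite) chart \<Rightarrow> complex^'d \<Rightarrow> 'a" where
  "chart_inv c = inv_into (fst c) (snd c)"

definition complex_manifold :: "'a topology \<Rightarrow> ('a, 'd::finite) chart set \<Rightarrow> bool" where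
  "complex_manifold X A \<longleftrightarrow>
     Hausdorff_space X \<and> second_countable X \<and>
     (\<Union>c\<in>A. fst c) = topspace X \<and>
     (\<forall>c\<in>A. openin X (fst c) \<and> open (snd c ` fst c) \<and>
        homeomorphic_map (subtopology X (fst c)) (top_of_set (snd c ` fst c)) (snd c)) \<and>
     (\<forall>c\<in>A. \<forall>c'\<in>A. cholomorphic_on (snd c' \<circ> chart_inv c) (snd c ` (fst c \<inter> fst c')))"

definition smooth_fun :: "('a, 'd::finite) chart set \<Rightarrow> ('a \<Rightarrow> 'b::real_normed_vector) \<Rightarrow> bool" where
  "smooth_fun A f \<longleftrightarrow> (\<forall>c\<in>A. smooth_on (snd c ` fst c) (f \<circ> chart_inv c))"

text \<open>The differential of \<open>f\<close> at the point \<open>x\<close>, in the charts \<open>c\<close> (at \<open>x\<close>) and \<open>d\<close> (at \<open>f x\<close>).\<close>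

definition tangent_map ::
  "('a, 'd::finite) chart \<Rightarrow> ('b, 'e::finite) chart \<Rightarrow> ('a \<Rightarrow> 'b) \<Rightarrow> 'a \<Rightarrow> complex^'d \<Rightarrow> complex^'e" where
  "tangent_map c d f x = frechet_derivative (snd d \<circ> f \<circ> chart_inv c) (at (snd c x))"

definition holomorphic_map ::
  "'a topology \<Rightarrow> ('a, 'd::finite) chart set \<Rightarrow> 'b topology \<Rightarrow> ('b, 'e::finite) chart set \<Rightarrow> ('a \<Rightarrow> 'b) \<Rightarrow> bool" where
  "holomorphic_map X A Y B f \<longleftrightarrow>
     continuous_map X Y f \<and>
     (\<forall>c\<in>A. \<forall>d\<in>B.
        cholomorphic_on (snd d \<circ> f \<circ> chart_inv c) (snd c ` {x \<in> fst c. f x \<in> fst d}))"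

definition holomorphic_embedding ::
  "'a topology \<Rightarrow> ('a, 'd::finite) chart set \<Rightarrow> 'b topology \<Rightarrow> ('b, 'e::finite) chart set \<Rightarrow> ('a \<Rightarrow> 'b) \<Rightarrow> bool" where
  "holomorphic_embedding X A Y B f \<longleftrightarrow>
     holomorphic_map X A Y B f \<and> embedding_map X Y f \<and>
     (\<forall>c\<in>A. \<forall>d\<in>B. \<forall>x\<in>fst c. f x \<in> fst d \<longrightarrow> inj (tangent_map c d f x))"


section \<open>Two-forms and Kaehler forms\<close>

text \<open>A real 2-form is given by its values, at each point of each chart domain, on pairs of tangent
  vectors expressed in that chart.\<close>

type_synonym ('a, 'd) form2 = "('a, 'd) chart \<Rightarrow> 'a \<Rightarrow> complex^'d \<Rightarrow> complex^'d \<Rightarrow> real"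

definition two_form :: "('a, 'd::finite) chart set \<Rightarrow> ('a, 'd) form2 \<Rightarrow> bool" where
  "two_form A \<omega> \<longleftrightarrow>
     (\<forall>c\<in>A. \<forall>x\<in>fst c. bilinear (\<omega> c x) \<and> (\<forall>u v. \<omega> c x u v = - \<omega> c x v u)) \<and>
     (\<forall>c\<in>A. \<forall>u v. smooth_on (snd c ` fst c) (\<lambda>y. \<omega> c (chart_inv c y) u v)) \<and>
     (\<forall>c\<in>A. \<forall>c'\<in>A. \<forall>x\<in>fst c \<inter> fst c'. \<forall>u v.
        \<omega> c x u v = \<omega> c' x (tangent_map c c' id x u) (tangent_map c c' id x v))"

definition closed_form2 :: "('a, 'd::finite) chart set \<Rightarrow> ('a, 'd) form2 \<Rightarrow> bool" where
  "closed_form2 A \<omega> \<longleftrightarrow>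
     (\<forall>c\<in>A. \<forall>x\<in>fst c. \<forall>u v w.
        frechet_derivative (\<lambda>y. \<omega> c (chart_inv c y) v w) (at (snd c x)) u
      + frechet_derivative (\<lambda>y. \<omega> c (chart_inv c y) w u) (at (snd c x)) v
      + frechet_derivative (\<lambda>y. \<omega> c (chart_inv c y) u v) (at (snd c x)) w = 0)"

definition kaehler_form :: "('a, 'd::finite) chart set \<Rightarrow> ('a, 'd) form2 \<Rightarrow> bool" where
  "kaehler_form A \<omega> \<longleftrightarrow>
     two_form A \<omega> \<and> closed_form2 A \<omega> \<and>
     (\<forall>c\<in>A. \<forall>x\<in>fst c.
        (\<forall>u v. \<omega> c x (\<i> *s u) (\<i> *s v) = \<omega> c x u v) \<and>
        (\<forall>u. u \<noteq> 0 \<longrightarrow> \<omega> c x u (\<i> *s u) > 0))"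

text \<open>For a 2-form on the target, the value does not depend on which chart at \<open>f x\<close> is selected.\<close>

definition pullback_form2 :: "('b, 'e::finite) chart set \<Rightarrow> ('a \<Rightarrow> 'b) \<Rightarrow> ('b, 'e) form2 \<Rightarrow> ('a, 'd::finite) form2" where
  "pullback_form2 B f \<omega> c x u v =
     (let d = (SOME d. d \<in> B \<and> f x \<in> fst d)
      in \<omega> d (f x) (tangent_map c d f x u) (tangent_map c d f x v))"

definition i_ddbar_form :: "('a \<Rightarrow> real) \<Rightarrow> ('a, 'd::finite) form2" where
  "i_ddbar_form f c x = i_ddbar (f \<circ> chart_inv c) (snd c x)"


section \<open>Torus actions and moment maps\<close>

definition complex_torus :: "(complex^'n) set" where
  "complex_torus = {\<zeta>. \<forall>j. \<zeta> $ j \<noteq> 0}"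

definition real_torus :: "(complex^'n) set" where
  "real_torus = {\<zeta>. \<forall>j. cmod (\<zeta> $ j) = 1}"

text \<open>Products and the unit of \<open>complex^'n\<close> are componentwise.\<close>

definition holomorphic_torus_action ::
  "'a topology \<Rightarrow> ('a, 'd::finite) chart set \<Rightarrow> (complex^'n \<Rightarrow> 'a \<Rightarrow> 'a) \<Rightarrow> bool" where
  "holomorphic_torus_action X A act \<longleftrightarrow>
     (\<forall>x\<in>topspace X. act 1 x = x) \<and>
     (\<forall>\<zeta>\<in>complex_torus. \<forall>\<eta>\<in>complex_torus. \<forall>x\<in>topspace X. act (\<zeta> * \<eta>) x = act \<zeta> (act \<eta> x)) \<and>
     continuous_map (prod_topology (top_of_set complex_torus) X) X (\<lambda>(\<zeta>, x). act \<zeta> x) \<and>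
     (\<forall>c\<in>A. \<forall>c'\<in>A. \<forall>\<zeta>\<in>complex_torus. \<forall>x\<in>fst c. act \<zeta> x \<in> fst c' \<longrightarrow>
        (\<exists>D. ((\<lambda>(\<eta>, y). snd c' (act \<eta> (chart_inv c y))) has_derivative D) (at (\<zeta>, snd c x)) \<and>
             (\<forall>a u v. D (a *s u, a *s v) = a *s D (u, v))))"

definition orbit :: "(complex^'n \<Rightarrow> 'a \<Rightarrow> 'a) \<Rightarrow> 'a \<Rightarrow> 'a set" where
  "orbit act x = (\<lambda>\<zeta>. act \<zeta> x) ` complex_torus"

text \<open>The value at \<open>x\<close>, in the chart \<open>c\<close>, of the vector field generated by the rotation
  \<open>\<theta> \<mapsto> (1, \<dots>, exp (\<i> \<theta>), \<dots>, 1)\<close> in the \<open>j\<close>-th factor of the real torus.\<close>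

definition generator :: "(complex^'n \<Rightarrow> 'a \<Rightarrow> 'a) \<Rightarrow> 'n \<Rightarrow> ('a, 'd::finite) chart \<Rightarrow> 'a \<Rightarrow> complex^'d" where
  "generator act j c x =
     vector_derivative (\<lambda>\<theta>::real. snd c (act (\<chi> k. if k = j then cis \<theta> else 1) x)) (at 0)"

text \<open>The dual of the Lie algebra is identified with \<open>real^'n\<close> by the coordinates \<open>\<theta>\<^sub>j\<close>.  The sign
  convention is the one for which \<open>\<i> \<partial>\<partial>\<close>-bar \<open>F = \<Sum> d(\<partial>F/\<partial>s\<^sub>j) \<and> d\<theta>\<^sub>j\<close>, on the complex torus with
  \<open>\<zeta>\<^sub>j = exp (s\<^sub>j/2 + \<i> \<theta>\<^sub>j)\<close>, has the moment map \<open>s \<mapsto> dF\<^sub>s\<close>.\<close>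

definition moment_map ::
  "'a topology \<Rightarrow> ('a, 'd::finite) chart set \<Rightarrow> ('a, 'd) form2 \<Rightarrow> (complex^'n \<Rightarrow> 'a \<Rightarrow> 'a)
     \<Rightarrow> ('a \<Rightarrow> real^'n) \<Rightarrow> bool" where
  "moment_map X A \<omega> act \<Phi> \<longleftrightarrow>
     smooth_fun A \<Phi> \<and>
     (\<forall>t\<in>real_torus. \<forall>x\<in>topspace X. \<Phi> (act t x) = \<Phi> x) \<and>
     (\<forall>c\<in>A. \<forall>x\<in>fst c. \<forall>j u.
        frechet_derivative (\<lambda>y. \<Phi> (chart_inv c y) $ j) (at (snd c x)) u
          = - \<omega> c x (generator act j c x) u)"

text \<open>The coordinates \<open>s\<close> on the torus, with \<open>exp s\<^sub>j = \<bar>\<zeta>\<^sub>j\<bar>\<^sup>2\<close>, and the restriction of a function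
  that is invariant under the real torus to the orbit of \<open>x\<close>, as a function of \<open>s\<close>.\<close>

definition log_coords :: "complex^'n \<Rightarrow> real^'n" where
  "log_coords \<zeta> = (\<chi> j. ln ((cmod (\<zeta> $ j))\<^sup>2))"

definition orbit_restriction ::
  "(complex^'n \<Rightarrow> 'a \<Rightarrow> 'a) \<Rightarrow> ('a \<Rightarrow> real) \<Rightarrow> 'a \<Rightarrow> real^'n \<Rightarrow> real" where
  "orbit_restriction act f x s = f (act (\<chi> j. complex_of_real (exp (s $ j / 2))) x)"

text \<open>The Legendre transform \<open>s \<mapsto> dF\<^sub>s\<close>, with covectors written in the dual of the standard basis.\<close>

definition legendre :: "(real^'n \<Rightarrow> real) \<Rightarrow> real^'n \<Rightarrow> real^'n" where
  "legendre F s = (\<chi> j. frechet_derivative F (at s) (axis j 1))"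

text \<open>\<open>\<Phi>\<close> restricted to the orbit of \<open>x\<close> is the Legendre transform of \<open>F\<close>.  A moment map is only
  unique up to an additive constant; this fixes the one determined by the potential \<open>F\<close>.\<close>

definition determined_by_potential ::
  "(complex^'n \<Rightarrow> 'a \<Rightarrow> 'a) \<Rightarrow> ('a \<Rightarrow> real^'n) \<Rightarrow> 'a \<Rightarrow> (real^'n \<Rightarrow> real) \<Rightarrow> bool" where
  "determined_by_potential act \<Phi> x F \<longleftrightarrow>
     (\<forall>\<zeta>\<in>complex_torus. \<Phi> (act \<zeta> x) = legendre F (log_coords \<zeta>))"


section \<open>Complex projective space\<close>

text \<open>Homogeneous coordinates are indexed by \<open>'N option\<close>, where \<open>CARD('N) = N\<close> and \<open>None\<close> plays the
  role of the index \<open>0\<close>.  A point is a line with the origin removed.\<close>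

type_synonym 'N cp = "(complex^('N option)) set"

definition cp_point :: "complex^('N::finite option) \<Rightarrow> 'N cp" where
  "cp_point a = {k *s a | k. k \<noteq> 0}"

definition cp_carrier :: "'N::finite cp set" where
  "cp_carrier = cp_point ` (- {0})"

definition cp_topology :: "'N::finite cp topology" where
  "cp_topology = topology (\<lambda>U. U \<subseteq> cp_carrier \<and> open {a. a \<noteq> 0 \<and> cp_point a \<in> U})"

definition cp_dom :: "'N::finite option \<Rightarrow> 'N cp set" where
  "cp_dom i = {P \<in> cp_carrier. \<forall>a\<in>P. a $ i \<noteq> 0}"

text \<open>The affine coordinates \<open>z\<^sub>k/z\<^sub>i\<close>, \<open>k \<noteq> i\<close>; for \<open>i = Some j\<close> the slot \<open>j\<close> holds \<open>z\<^sub>0/z\<^sub>i\<close>.\<close>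

definition cp_coord :: "'N::finite option \<Rightarrow> 'N cp \<Rightarrow> complex^'N" where
  "cp_coord i P =
     (let a = (SOME a. a \<in> P) in \<chi> j. a $ (if Some j = i then None else Some j) / a $ i)"

definition cp_atlas :: "('N::finite cp, 'N) chart set" where
  "cp_atlas = range (\<lambda>i. (cp_dom i, cp_coord i))"

definition cp_potential :: "'N::finite option \<Rightarrow> 'N cp \<Rightarrow> real" where
  "cp_potential i P =
     (let a = (SOME a. a \<in> P) in ln ((\<Sum>k\<in>UNIV. (cmod (a $ k))\<^sup>2) / (cmod (a $ i))\<^sup>2))"

text \<open>The form that equals \<open>\<i> \<partial>\<partial>\<close>-bar of \<open>cp_potential i\<close> on \<open>cp_dom i\<close>: in each affine chart,
  the potential is \<open>ln (1 + \<bar>w\<bar>\<^sup>2)\<close>.\<close>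

definition fubini_study :: "('N::finite cp, 'N) form2" where
  "fubini_study c P = i_ddbar (\<lambda>w. ln (1 + (\<Sum>j\<in>UNIV. (cmod (w $ j))\<^sup>2))) (snd c P)"

text \<open>The action induced by the linear action on \<open>complex^('N option)\<close> with the weights \<open>\<beta>\<close>.\<close>

definition cp_action ::
  "('N::finite option \<Rightarrow> int^'n) \<Rightarrow> complex^'n \<Rightarrow> 'N cp \<Rightarrow> 'N cp" where
  "cp_action \<beta> \<zeta> P = (\<lambda>a. \<chi> k. (\<Prod>j\<in>UNIV. (\<zeta> $ j) powi (\<beta> k $ j)) * a $ k) ` P"

lemma openin_cp_topology:
  fixes U :: "'N::finite cp set"
  shows "openin cp_topology U \<longleftrightarrow> U \<subseteq> cp_carrier \<and> open {a. a \<noteq> 0 \<and> cp_point a \<in> U}"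
proof -
  have "istopology (\<lambda>U :: 'N cp set. U \<subseteq> cp_carrier \<and> open {a. a \<noteq> 0 \<and> cp_point a \<in> U})"
    unfolding istopology_def
  proof (intro conjI allI impI; (elim conjE)?)
    fix S T :: "'N cp set"
    assume "open {a. a \<noteq> 0 \<and> cp_point a \<in> S}" "open {a. a \<noteq> 0 \<and> cp_point a \<in> T}"
    then have "open ({a. a \<noteq> 0 \<and> cp_point a \<in> S} \<inter> {a. a \<noteq> 0 \<and> cp_point a \<in> T})"
      by (rule open_Int)
    moreover have "{a. a \<noteq> 0 \<and> cp_point a \<in> S} \<inter> {a. a \<noteq> 0 \<and> cp_point a \<in> T}
        = {a. a \<noteq> 0 \<and> cp_point a \<in> S \<inter> T}" by auto
    ultimately show "open {a. a \<noteq> 0 \<and> cp_point a \<in> S \<inter> T}" by simp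
  next
    fix S T :: "'N cp set"
    assume "S \<subseteq> cp_carrier"
    then show "S \<inter> T \<subseteq> cp_carrier" by blast
  next
    fix \<K> :: "'N cp set set"
    assume *: "\<forall>K\<in>\<K>. K \<subseteq> cp_carrier \<and> open {a. a \<noteq> 0 \<and> cp_point a \<in> K}"
    then have "open (\<Union>K\<in>\<K>. {a. a \<noteq> 0 \<and> cp_point a \<in> K})" by blast
    moreover have "(\<Union>K\<in>\<K>. {a. a \<noteq> 0 \<and> cp_point a \<in> K}) = {a. a \<noteq> 0 \<and> cp_point a \<in> \<Union>\<K>}" by auto
    ultimately show "open {a. a \<noteq> 0 \<and> cp_point a \<in> \<Union>\<K>}" by simp
    show "\<Union>\<K> \<subseteq> cp_carrier" using * by blast
  qed
  then show ?thesis by (simp add: cp_topology_def)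
qed

lemma cp_potential_point:
  shows "cp_potential i (cp_point a) = ln ((\<Sum>k\<in>UNIV. (cmod (a $ k))\<^sup>2) / (cmod (a $ i))\<^sup>2)"
proof -
  have "(SOME b. b \<in> cp_point a) \<in> cp_point a"
    by (rule someI[of _ a]) (auto simp: cp_point_def intro!: exI[of _ 1])
  then obtain k where "k \<noteq> 0" "(SOME b. b \<in> cp_point a) = k *s a" by (auto simp: cp_point_def)
  then show ?thesis
    by (simp add: cp_potential_def Let_def norm_mult power_mult_distrib flip: sum_distrib_left)
qed

text \<open>The restriction of the potential to an orbit, in the coordinates \<open>s\<close>, is the logarithm of an
  exponential sum.\<close>

lemma orbit_restriction_cp_potential:
  assumes "a $ r = 1"
  shows "orbit_restriction (cp_action \<beta>) (cp_potential r) (cp_point a) s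
       = ln (\<Sum>k\<in>UNIV. (cmod (a $ k))\<^sup>2
              * exp (\<Sum>j\<in>UNIV. of_int (\<beta> k $ j - \<beta> r $ j) * s $ j))"
proof -
  define \<zeta> :: "complex^'b" where "\<zeta> = (\<chi> j. complex_of_real (exp (s $ j / 2)))"
  define m where "m k = (\<Prod>j\<in>UNIV. (\<zeta> $ j) powi (\<beta> k $ j))" for k
  have img: "cp_action \<beta> \<zeta> (cp_point a) = cp_point (\<chi> k. m k * a $ k)"
  proof (intro set_eqI iffI)
    fix x assume "x \<in> cp_action \<beta> \<zeta> (cp_point a)"
    then obtain c where "c \<noteq> 0" "x = (\<chi> k. m k * (c *s a) $ k)"
      by (auto simp: cp_action_def cp_point_def m_def)
    then show "x \<in> cp_point (\<chi> k. m k * a $ k)"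
      by (auto simp: cp_point_def vec_eq_iff intro!: exI[of _ c])
  next
    fix x assume "x \<in> cp_point (\<chi> k. m k * a $ k)"
    then obtain c where "c \<noteq> 0" "x = c *s (\<chi> k. m k * a $ k)" by (auto simp: cp_point_def)
    then have "x = (\<chi> k. m k * (c *s a) $ k)" "c *s a \<in> cp_point a"
      by (auto simp: cp_point_def vec_eq_iff)
    then show "x \<in> cp_action \<beta> \<zeta> (cp_point a)" unfolding cp_action_def m_def by blast
  qed
  have "(cmod (\<zeta> $ j powi b))\<^sup>2 = exp (of_int b * s $ j)" for j b
    by (simp add: \<zeta>_def norm_power_int exp_power_int power2_eq_square flip: exp_add)
  then have m: "(cmod (m k))\<^sup>2 = exp (\<Sum>j\<in>UNIV. of_int (\<beta> k $ j) * s $ j)" for k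
    by (simp add: m_def prod_norm[symmetric] prod_power_distrib exp_sum)
  have "(\<Sum>k\<in>UNIV. (cmod (m k * a $ k))\<^sup>2) / (cmod (m r * a $ r))\<^sup>2
      = (\<Sum>k\<in>UNIV. (cmod (a $ k))\<^sup>2 * exp (\<Sum>j\<in>UNIV. of_int (\<beta> k $ j - \<beta> r $ j) * s $ j))"
    using assms
    by (simp add: norm_mult power_mult_distrib m sum_divide_distrib left_diff_distrib
        sum_subtractf exp_diff) (simp add: mult.commute)
  then show ?thesis
    by (simp add: orbit_restriction_def cp_potential_point img flip: \<zeta>_def)
qed

end

theory Submission
  imports Defs
begin

text \<open>In the coordinates \<open>s\<close> the moment images are the gradient images of two potentials: of the
  exponential sum \<open>F\<close>, whose exponents \<open>\<alpha> k\<close> are the relative weights of the nonzero homogeneous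
  coordinates of \<open>p\<close>, and of \<open>F1 = F + h\<close>, where \<open>h\<close> is the restriction of \<open>H\<close>.  Since \<open>H\<close> is
  continuous on a compact manifold, \<open>h\<close> is bounded.  Both images are shown to be the relative interior
  of the polytope \<open>P\<close> spanned by the exponents.

  Every point \<open>y\<close> of the relative interior is a gradient of any differentiable function \<open>G\<close> at bounded
  distance from \<open>F\<close> with gradients in the affine hull of \<open>P\<close>: \<open>F\<close> grows like the support function of
  \<open>P\<close>, so \<open>s \<mapsto> G s - s \<bullet> y\<close> attains a minimum along the directions of \<open>P\<close>
  (\<open>rel_interior_subset_gradient_image\<close>).

  Conversely, gradients of \<open>F\<close> are averages of the exponents with positive weights.  For \<open>F1\<close> this
  needs convexity.  By the defining equation of the moment map, the Hessian of \<open>F1\<close> in the direction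
  \<open>v\<close> is half the squared Kaehler length of the infinitesimal action of \<open>v\<close>
  (\<open>moment_map_monotone_along_orbit\<close>), and the equivariant embedding shows that this action
  is nonzero as soon as \<open>v\<close> is nonzero on some exponent (\<open>infinitesimal_action_nonzero\<close>).  A function
  that is convex, strictly so in these directions, and at bounded distance from \<open>F\<close> has slopes along
  every ray that stay below the support function of \<open>P\<close>, which places its gradients in the relative
  interior (\<open>gradient_in_rel_interior\<close>).\<close>

section \<open>The relative interior of a polytope\<close>

text \<open>The relative interior is cut out by the failure of proper support: a linear functional that
  takes its maximum over the polytope at the point must be constant on the polytope.  In this form,
  membership can be tested on one direction \<open>v\<close> at a time.\<close>

lemma rel_interior_convex_hull_iff_support:
  fixes S :: "'e::euclidean_space set"
  assumes "S \<noteq> {}" "finite S"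
  shows "y \<in> rel_interior (convex hull S) \<longleftrightarrow>
    (\<forall>v. (\<forall>x\<in>S. v \<bullet> x \<le> v \<bullet> y) \<longrightarrow> (\<forall>x\<in>S. v \<bullet> x = v \<bullet> y))"
proof (intro iffI allI impI)
  fix v
  assume y: "y \<in> rel_interior (convex hull S)" and "\<forall>x\<in>S. v \<bullet> x \<le> v \<bullet> y"
  then have "S \<subseteq> {x. v \<bullet> x \<le> v \<bullet> y}" by auto
  then have P: "convex hull S \<subseteq> {x. v \<bullet> x \<le> v \<bullet> y}"
    by (intro hull_minimal convex_halfspace_le)
  show "\<forall>x\<in>S. v \<bullet> x = v \<bullet> y"
  proof
    fix x assume "x \<in> S"
    then have x: "x \<in> convex hull S" by (simp add: hull_inc)
    then obtain e where e: "e > 1" "(1 - e) *\<^sub>R x + e *\<^sub>R y \<in> convex hull S"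
      using y assms(1) convex_rel_interior_iff[of "convex hull S" y] by (auto simp: convex_convex_hull)
    then have "(1 - e) * (v \<bullet> x) + e * (v \<bullet> y) \<le> v \<bullet> y"
      using P by (auto simp: inner_add_right)
    then have "(e - 1) * (v \<bullet> y) \<le> (e - 1) * (v \<bullet> x)" by (simp add: algebra_simps)
    then have "v \<bullet> y \<le> v \<bullet> x" using e by simp
    then show "v \<bullet> x = v \<bullet> y" using P x by auto
  qed
next
  assume *: "\<forall>v. (\<forall>x\<in>S. v \<bullet> x \<le> v \<bullet> y) \<longrightarrow> (\<forall>x\<in>S. v \<bullet> x = v \<bullet> y)"
  have closed: "closed (convex hull S)"
    using assms by (simp add: compact_convex_hull compact_imp_closed finite_imp_compact)
  have mem: "y \<in> convex hull S"
  proof (rule ccontr)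
    assume "y \<notin> convex hull S"
    then obtain a b where "a \<bullet> y < b" "\<forall>x\<in>convex hull S. a \<bullet> x > b"
      using separating_hyperplane_closed_point[OF _ closed] by blast
    then have "(- a) \<bullet> x < (- a) \<bullet> y" if "x \<in> S" for x
      using hull_inc[OF that, of convex] by fastforce
    then show False using *[rule_format, of "- a"] assms(1) by (metis all_not_in_conv less_imp_le less_irrefl)
  qed
  show "y \<in> rel_interior (convex hull S)"
  proof (rule ccontr)
    assume y: "y \<notin> rel_interior (convex hull S)"
    obtain a where "a \<noteq> 0" and a: "\<And>x. x \<in> convex hull S \<Longrightarrow> a \<bullet> y \<le> a \<bullet> x"
      "\<And>x. x \<in> rel_interior (convex hull S) \<Longrightarrow> a \<bullet> y < a \<bullet> x"
      by (rule supporting_hyperplane_rel_boundary[OF convex_convex_hull mem y]) blast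
    have "\<forall>x\<in>S. (- a) \<bullet> x \<le> (- a) \<bullet> y" by (simp add: a(1) hull_inc)
    then have "\<forall>x\<in>S. a \<bullet> x = a \<bullet> y" using * by (metis inner_minus_left neg_equal_iff_equal)
    then have "S \<subseteq> {x. a \<bullet> x = a \<bullet> y}" by auto
    then have "convex hull S \<subseteq> {x. a \<bullet> x = a \<bullet> y}"
      by (intro hull_minimal convex_hyperplane)
    moreover obtain z where "z \<in> rel_interior (convex hull S)"
      using assms(1) rel_interior_eq_empty[of "convex hull S"] by auto
    ultimately show False using a(2)[of z] rel_interior_subset[of "convex hull S"] by force
  qed
qed

section \<open>Logarithms of exponential sums\<close>

definition log_exp_sum :: "'k set \<Rightarrow> ('k \<Rightarrow> real) \<Rightarrow> ('k \<Rightarrow> 'e::euclidean_space) \<Rightarrow> 'e \<Rightarrow> real" where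
  "log_exp_sum K c \<alpha> s = ln (\<Sum>k\<in>K. c k * exp (\<alpha> k \<bullet> s))"

lemma exp_sum_pos:
  assumes "finite K" "K \<noteq> {}" "\<And>k. k \<in> K \<Longrightarrow> c k > 0"
  shows "(\<Sum>k\<in>K. c k * exp (\<alpha> k \<bullet> s)) > 0"
  using assms by (intro sum_pos) auto

text \<open>The gradient is an average of the exponents \<open>\<alpha> k\<close> with strictly positive weights, so a
  functional that is maximal at it among the exponents is constant on them.\<close>

lemma log_exp_sum_has_derivative:
  fixes \<alpha> :: "'k \<Rightarrow> 'e::euclidean_space"
  assumes "finite K" "K \<noteq> {}" "\<And>k. k \<in> K \<Longrightarrow> c k > 0"
  shows "\<exists>y\<in>rel_interior (convex hull (\<alpha> ` K)).
    (log_exp_sum K c \<alpha> has_derivative (\<lambda>v. v \<bullet> y)) (at s)"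
proof -
  define Z where "Z = (\<Sum>k\<in>K. c k * exp (\<alpha> k \<bullet> s))"
  define w where "w k = c k * exp (\<alpha> k \<bullet> s) / Z" for k
  have ne: "\<alpha> ` K \<noteq> {}" and fin: "finite (\<alpha> ` K)" using assms by auto
  have Z: "Z > 0" unfolding Z_def by (rule exp_sum_pos[OF assms])
  have w: "\<And>k. k \<in> K \<Longrightarrow> w k > 0" "sum w K = 1"
    using Z assms by (auto simp: w_def Z_def sum_divide_distrib[symmetric])
  define y where "y = (\<Sum>k\<in>K. w k *\<^sub>R \<alpha> k)"
  have "((\<lambda>s. ln (\<Sum>k\<in>K. c k * exp (\<alpha> k \<bullet> s))) has_derivative
        (\<lambda>v. (\<Sum>k\<in>K. c k * (exp (\<alpha> k \<bullet> s) * (\<alpha> k \<bullet> v))) * inverse Z)) (at s)"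
    using Z unfolding Z_def by (auto intro!: derivative_eq_intros simp: mult_ac)
  also have "(\<lambda>v. (\<Sum>k\<in>K. c k * (exp (\<alpha> k \<bullet> s) * (\<alpha> k \<bullet> v))) * inverse Z) = (\<lambda>v. v \<bullet> y)"
    by (simp add: fun_eq_iff y_def w_def inner_sum_right sum_distrib_left inner_commute
        divide_inverse mult_ac)
  finally have "(log_exp_sum K c \<alpha> has_derivative (\<lambda>v. v \<bullet> y)) (at s)"
    by (simp add: log_exp_sum_def[abs_def])
  moreover have "y \<in> rel_interior (convex hull (\<alpha> ` K))"
    unfolding rel_interior_convex_hull_iff_support[OF ne fin]
  proof (intro allI impI)
    fix v assume "\<forall>x\<in>\<alpha> ` K. v \<bullet> x \<le> v \<bullet> y"
    then have le: "\<forall>k\<in>K. 0 \<le> w k * (v \<bullet> y - v \<bullet> \<alpha> k)"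
      using w(1) by (auto intro!: mult_nonneg_nonneg simp: less_imp_le)
    have "(\<Sum>k\<in>K. w k * (v \<bullet> y - v \<bullet> \<alpha> k)) = sum w K * (v \<bullet> y) - (\<Sum>k\<in>K. w k * (v \<bullet> \<alpha> k))"
      by (simp add: right_diff_distrib sum_subtractf sum_distrib_right)
    also have "\<dots> = 0" by (simp add: w(2)) (simp add: y_def inner_sum_right)
    finally have "\<forall>k\<in>K. w k * (v \<bullet> y - v \<bullet> \<alpha> k) = 0"
      using le assms(1) by (simp add: sum_nonneg_eq_0_iff)
    then show "\<forall>x\<in>\<alpha> ` K. v \<bullet> x = v \<bullet> y" using w(1) by fastforce
  qed
  ultimately show ?thesis by blast
qed

text \<open>This and the next bound say that the exponential sum grows like the support function
  \<open>s \<mapsto> Max (\<alpha> k \<bullet> s)\<close> of the polytope; a bounded perturbation does not change that.\<close>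

lemma log_exp_sum_ge:
  fixes \<alpha> :: "'k \<Rightarrow> 'e::euclidean_space"
  assumes "finite K" "\<And>k. k \<in> K \<Longrightarrow> c k > 0" "k \<in> K"
  shows "ln (c k) + \<alpha> k \<bullet> s \<le> log_exp_sum K c \<alpha> s"
proof -
  have "c k * exp (\<alpha> k \<bullet> s) \<le> (\<Sum>k\<in>K. c k * exp (\<alpha> k \<bullet> s))"
    using assms by (intro member_le_sum) (auto simp: less_imp_le)
  moreover have "c k * exp (\<alpha> k \<bullet> s) > 0" using assms by simp
  ultimately have "ln (c k * exp (\<alpha> k \<bullet> s)) \<le> log_exp_sum K c \<alpha> s"
    unfolding log_exp_sum_def by (subst ln_le_cancel_iff) auto
  moreover have "ln (c k * exp (\<alpha> k \<bullet> s)) = ln (c k) + \<alpha> k \<bullet> s"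
    using assms(2)[OF assms(3)] by (simp add: ln_mult)
  ultimately show ?thesis by simp
qed

lemma log_exp_sum_ray_le:
  fixes \<alpha> :: "'k \<Rightarrow> 'e::euclidean_space"
  assumes "finite K" "K \<noteq> {}" "\<And>k. k \<in> K \<Longrightarrow> c k > 0"
    and "\<And>k. k \<in> K \<Longrightarrow> \<alpha> k \<bullet> v \<le> M" "t \<ge> 0"
  shows "log_exp_sum K c \<alpha> (s + t *\<^sub>R v) \<le> log_exp_sum K c \<alpha> s + t * M"
proof -
  have "(\<Sum>k\<in>K. c k * exp (\<alpha> k \<bullet> (s + t *\<^sub>R v))) \<le> (\<Sum>k\<in>K. c k * (exp (\<alpha> k \<bullet> s) * exp (t * M)))"
    using assms
    by (intro sum_mono mult_left_mono)
       (auto simp: inner_add_right mult_left_mono less_imp_le simp flip: exp_add)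
  also have "\<dots> = (\<Sum>k\<in>K. c k * exp (\<alpha> k \<bullet> s)) * exp (t * M)"
    by (simp add: sum_distrib_right mult.assoc)
  finally have "log_exp_sum K c \<alpha> (s + t *\<^sub>R v) \<le> ln ((\<Sum>k\<in>K. c k * exp (\<alpha> k \<bullet> s)) * exp (t * M))"
    unfolding log_exp_sum_def
    using exp_sum_pos[where c = c, OF assms(1-3)] by (subst ln_le_cancel_iff) auto
  also have "\<dots> = log_exp_sum K c \<alpha> s + t * M"
    using exp_sum_pos[where c = c, OF assms(1-3), of \<alpha> s] by (simp add: ln_mult log_exp_sum_def)
  finally show ?thesis .
qed

section \<open>Gradient images of bounded perturbations\<close>

text \<open>The point \<open>s\<close> with \<open>g s = y\<close> is found by minimizing \<open>G s - s \<bullet> y\<close>.  Since \<open>y\<close> is relatively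
  interior, a small ball around it in the affine hull still lies in the polytope, and this makes the
  function grow linearly along the direction space \<open>L\<close> of the affine hull.  So a minimum over \<open>L\<close>
  exists, and there \<open>g s - y\<close> is orthogonal to \<open>L\<close>; as it also lies in \<open>L\<close>, it vanishes.\<close>

lemma rel_interior_subset_gradient_image:
  fixes \<alpha> :: "'k \<Rightarrow> 'e::euclidean_space"
  assumes K: "finite K" "K \<noteq> {}" "\<And>k. k \<in> K \<Longrightarrow> c k > 0"
    and grad: "\<And>s. (G has_derivative (\<lambda>v. v \<bullet> g s)) (at s)"
    and aff: "\<And>s. g s \<in> affine hull (\<alpha> ` K)"
    and bounded: "\<And>s. \<bar>G s - log_exp_sum K c \<alpha> s\<bar> \<le> B"
    and y: "y \<in> rel_interior (convex hull (\<alpha> ` K))"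
  shows "y \<in> range g"
proof -
  define P where "P = convex hull (\<alpha> ` K)"
  define L where "L = span ((\<lambda>x. x - y) ` P)"
  have "y \<in> P" using y rel_interior_subset by (auto simp: P_def)
  then have L: "L = (\<lambda>x. x - y) ` (affine hull P)"
    unfolding L_def by (rule diffs_affine_hull_span[symmetric])
  have affP: "affine hull P = affine hull (\<alpha> ` K)" by (simp add: P_def)
  obtain e where e: "e > 0" "cball y e \<inter> affine hull P \<subseteq> P"
    using y unfolding rel_interior_cball P_def by auto
  define m where "m = Min ((\<lambda>k. ln (c k)) ` K)"
  define f where "f s = G s - s \<bullet> y" for s
  have coercive: "f u \<ge> m - B + e * norm u" if u: "u \<in> L" for u
  proof -
    \<comment> \<open>The point of the polytope at distance \<open>e\<close> from \<open>y\<close> in the direction \<open>u\<close>;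
        some exponent lies at least as far in that direction.\<close>
    define z where "z = y + (e / norm u) *\<^sub>R u"
    have "(e / norm u) *\<^sub>R u \<in> L" using u by (simp add: L_def span_mul)
    then have "z \<in> affine hull P" unfolding L z_def by force
    moreover have "z \<in> cball y e" using e(1) by (simp add: z_def dist_norm)
    ultimately have zP: "z \<in> P" using e by auto
    have "\<exists>k\<in>K. u \<bullet> z \<le> u \<bullet> \<alpha> k"
    proof (rule ccontr)
      assume "\<not> ?thesis"
      then have "\<alpha> ` K \<subseteq> {x. u \<bullet> x < u \<bullet> z}" by auto
      then have "P \<subseteq> {x. u \<bullet> x < u \<bullet> z}"
        unfolding P_def by (intro hull_minimal convex_halfspace_lt)
      then show False using zP by auto
    qed
    then obtain k where k: "k \<in> K" "u \<bullet> z \<le> u \<bullet> \<alpha> k" by blast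
    have "u \<bullet> z = u \<bullet> y + e * norm u"
      by (cases "u = 0") (auto simp: z_def inner_add_right power2_norm_eq_inner[symmetric] power2_eq_square)
    moreover have "m \<le> ln (c k)" unfolding m_def using K k by (intro Min_le) auto
    moreover have "ln (c k) + \<alpha> k \<bullet> u \<le> log_exp_sum K c \<alpha> u"
      using K k by (intro log_exp_sum_ge) auto
    ultimately show ?thesis using k(2) bounded[of u] by (simp add: f_def inner_commute)
  qed
  \<comment> \<open>Beyond this radius the linear growth exceeds the value at the origin.\<close>
  define R where "R = max 0 ((f 0 - m + B) / e)"
  have f_deriv: "(f has_derivative (\<lambda>v. v \<bullet> g s - v \<bullet> y)) (at s)" for s
    unfolding f_def by (intro derivative_intros grad)
  have "compact (cball 0 R \<inter> L)" by (simp add: L_def compact_Int_closed closed_subspace)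
  moreover have "0 \<in> cball 0 R \<inter> L" by (simp add: R_def L_def span_zero)
  moreover have "continuous_on (cball 0 R \<inter> L) f"
    by (meson f_deriv continuous_at_imp_continuous_on has_derivative_continuous)
  ultimately obtain s where s: "s \<in> L" "\<And>u. u \<in> cball 0 R \<inter> L \<Longrightarrow> f s \<le> f u"
    using continuous_attains_inf[of "cball 0 R \<inter> L" f] by blast
  have min: "f s \<le> f u" if "u \<in> L" for u
  proof (cases "norm u \<le> R")
    case False
    then have "(f 0 - m + B) / e < norm u" by (simp add: R_def)
    then have "f 0 \<le> f u" using coercive[OF that] e(1) by (simp add: field_simps)
    then show ?thesis using s(2)[of 0] by (simp add: R_def L_def span_zero)
  qed (use s that in auto)
  define v where "v = g s - y"
  have vL: "v \<in> L" unfolding L v_def using aff[of s] affP by auto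
  have "((\<lambda>t. f (s + t *\<^sub>R v)) has_derivative (\<lambda>t. (t *\<^sub>R v) \<bullet> g s - (t *\<^sub>R v) \<bullet> y)) (at 0)"
    by (rule has_derivative_compose[of "\<lambda>t. s + t *\<^sub>R v" _ 0 UNIV f, simplified])
       (auto intro!: derivative_eq_intros f_deriv)
  moreover have "\<forall>t. f (s + 0 *\<^sub>R v) \<le> f (s + t *\<^sub>R v)"
    using s(1) vL by (auto intro!: min simp: L_def span_add span_mul)
  ultimately have "(\<lambda>t. (t *\<^sub>R v) \<bullet> g s - (t *\<^sub>R v) \<bullet> y) = (\<lambda>t. 0)"
    by (intro differential_zero_maxmin[of 0 UNIV]) auto
  then have "v \<bullet> v = 0" by (auto simp: v_def inner_diff_right dest: fun_cong[of _ _ 1])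
  then show ?thesis by (auto simp: v_def)
qed

text \<open>A convex function with a slope above \<open>M\<close> stays above a line of that slope, and so overtakes every
  line of slope \<open>M\<close>.\<close>

lemma slope_le_of_linear_bound:
  fixes f :: "real \<Rightarrow> real"
  assumes deriv: "\<And>t. (f has_real_derivative f' t) (at t)" and mono: "mono f'"
    and bound: "\<And>t. t \<ge> 0 \<Longrightarrow> f t \<le> C + t * M"
  shows "f' t \<le> M"
proof (rule ccontr)
  assume "\<not> f' t \<le> M"
  then have d: "f' t - M > 0" by simp
  \<comment> \<open>The bound is only available on the half line, hence the move to a nonnegative point.\<close>
  define r where "r = max 0 t"
  have r: "r \<ge> 0" "f' r - M > 0" using monoD[OF mono, of t r] d by (auto simp: r_def)
  \<comment> \<open>Far enough for the excess slope to use up the gap between \<open>f r\<close> and the bound at \<open>r\<close>.\<close>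
  define u where "u = (\<bar>C + r * M - f r\<bar> + 1) / (f' r - M)"
  have u: "u > 0" "u * (f' r - M) > C + r * M - f r"
    using r(2) by (auto simp: u_def)
  obtain z where z: "z > r" "f (r + u) - f r = u * f' z"
    using MVT2[of r "r + u" f f'] deriv u(1) by auto
  have "u * f' r \<le> f (r + u) - f r" using z(1) u(1) monoD[OF mono, of r z] by (simp add: z(2))
  moreover have "f (r + u) \<le> C + (r + u) * M" using u r by (intro bound) simp
  ultimately show False using u(2) by (simp add: algebra_simps)
qed

text \<open>Along a ray in the direction \<open>v\<close>, the function \<open>G\<close> is convex and grows at most like the maximum
  \<open>M\<close> of \<open>v\<close> over the exponents, so its slope never exceeds \<open>M\<close>.  If \<open>v\<close> separates the exponents,
  the slope strictly increases, so it cannot attain \<open>M\<close> either.  Hence a functional that is maximal at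
  \<open>g s\<close> among the exponents does not separate them, and then the slope bound forces equality.\<close>

lemma gradient_in_rel_interior:
  fixes \<alpha> :: "'k \<Rightarrow> 'e::euclidean_space"
  assumes K: "finite K" "K \<noteq> {}" "\<And>k. k \<in> K \<Longrightarrow> c k > 0"
    and grad: "\<And>s. (G has_derivative (\<lambda>v. v \<bullet> g s)) (at s)"
    and mono: "\<And>s v. v \<bullet> g s \<le> v \<bullet> g (s + v)"
    and strict: "\<And>s v k l. k \<in> K \<Longrightarrow> l \<in> K \<Longrightarrow> v \<bullet> \<alpha> k \<noteq> v \<bullet> \<alpha> l \<Longrightarrow> v \<bullet> g s < v \<bullet> g (s + v)"
    and bounded: "\<And>s. \<bar>G s - log_exp_sum K c \<alpha> s\<bar> \<le> B"
  shows "g s \<in> rel_interior (convex hull (\<alpha> ` K))"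
proof -
  have slope: "v \<bullet> g s \<le> M" if M: "\<And>k. k \<in> K \<Longrightarrow> v \<bullet> \<alpha> k \<le> M" for s v M
  proof -
    have "((\<lambda>t. G (s + t *\<^sub>R v)) has_derivative (\<lambda>h. (h *\<^sub>R v) \<bullet> g (s + t *\<^sub>R v))) (at t)" for t
      by (rule has_derivative_compose[of "\<lambda>t. s + t *\<^sub>R v" _ t UNIV G, simplified])
         (auto intro!: derivative_eq_intros grad)
    then have d: "((\<lambda>t. G (s + t *\<^sub>R v)) has_real_derivative v \<bullet> g (s + t *\<^sub>R v)) (at t)" for t
      by (simp add: has_field_derivative_def mult.commute[of _ "v \<bullet> _"] fun_eq_iff)
    have "mono (\<lambda>t. v \<bullet> g (s + t *\<^sub>R v))"
    proof (rule monoI)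
      fix a b :: real assume "a \<le> b"
      then obtain h where h: "h \<ge> 0" "b = a + h" by (metis add.commute diff_add_cancel diff_ge_0_iff_ge)
      have "h * (v \<bullet> g (s + a *\<^sub>R v)) \<le> h * (v \<bullet> g (s + b *\<^sub>R v))"
        using mono[of "h *\<^sub>R v" "s + a *\<^sub>R v"] by (simp add: h(2) scaleR_add_left add.assoc)
      then show "v \<bullet> g (s + a *\<^sub>R v) \<le> v \<bullet> g (s + b *\<^sub>R v)"
        using h by (cases "h = 0") auto
    qed
    moreover have "G (s + t *\<^sub>R v) \<le> (log_exp_sum K c \<alpha> s + B) + t * M" if "t \<ge> 0" for t
      using log_exp_sum_ray_le[where c = c, OF K, of \<alpha> v M t s] M that bounded[of "s + t *\<^sub>R v"]
      by (simp add: inner_commute abs_le_iff)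
    ultimately show ?thesis
      using slope_le_of_linear_bound[OF d, of "log_exp_sum K c \<alpha> s + B" M 0] by simp
  qed
  have "\<forall>k\<in>K. v \<bullet> \<alpha> k = v \<bullet> g s" if le: "\<forall>k\<in>K. v \<bullet> \<alpha> k \<le> v \<bullet> g s" for v
  proof (cases "\<exists>k\<in>K. \<exists>l\<in>K. v \<bullet> \<alpha> k \<noteq> v \<bullet> \<alpha> l")
    case True
    \<comment> \<open>Here \<open>v \<bullet> g s\<close> would be an upper bound of the exponents
        that the slope exceeds one step later.\<close>
    then have "v \<bullet> g s < v \<bullet> g (s + v)" using strict by blast
    also have "\<dots> \<le> v \<bullet> g s" using le by (intro slope) auto
    finally show ?thesis by simp
  next
    case False
    have "v \<bullet> \<alpha> k = v \<bullet> g s" if "k \<in> K" for k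
    proof -
      have "v \<bullet> \<alpha> l \<le> v \<bullet> \<alpha> k" if "l \<in> K" for l
        using False \<open>k \<in> K\<close> that by (metis order_refl)
      then have "v \<bullet> g s \<le> v \<bullet> \<alpha> k" by (rule slope)
      then show ?thesis using bspec[OF le that] by simp
    qed
    then show ?thesis by blast
  qed
  then show ?thesis
    using K by (subst rel_interior_convex_hull_iff_support) auto
qed

section \<open>Orbits in logarithmic coordinates\<close>

text \<open>The point of the torus with trivial angles that has the coordinates \<open>s\<close>.  These points form the
  noncompact factor of the torus, on which \<open>log_coords\<close> is a bijection.\<close>

definition exp_point :: "real^'n \<Rightarrow> complex^'n::finite" where
  "exp_point s = (\<chi> j. complex_of_real (exp (s $ j / 2)))"

lemma exp_point_in_torus: "exp_point s \<in> complex_torus"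
  by (simp add: exp_point_def complex_torus_def)

lemma exp_point_add: "exp_point (s + w) = exp_point s * exp_point w"
  by (simp add: exp_point_def vec_eq_iff add_divide_distrib exp_add)

lemma exp_point_0: "exp_point 0 = 1"
  by (simp add: exp_point_def vec_eq_iff)

lemma log_coords_exp_point: "log_coords (exp_point s) = s"
  by (simp add: exp_point_def log_coords_def vec_eq_iff ln_realpow)

text \<open>The potential gives the moment map at every point of the orbit, and the logarithmic coordinates
  of these points exhaust the vector space.\<close>

lemma moment_image_eq_range_legendre:
  assumes "determined_by_potential act \<Phi> x F"
  shows "\<Phi> ` orbit act x = range (legendre F)"
proof -
  have "\<Phi> ` orbit act x = legendre F ` log_coords ` complex_torus"
    using assms by (auto simp: orbit_def determined_by_potential_def image_iff)
  also have "log_coords ` complex_torus = (UNIV :: (real^'a) set)"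
    by (metis (no_types, lifting) UNIV_eq_I exp_point_in_torus image_eqI log_coords_exp_point)
  finally show ?thesis .
qed

lemma has_derivative_legendre:
  assumes "F differentiable (at s)"
  shows "(F has_derivative (\<lambda>v. v \<bullet> legendre F s)) (at s)"
proof -
  have d: "(F has_derivative frechet_derivative F (at s)) (at s)"
    using assms by (simp add: frechet_derivative_works)
  have "frechet_derivative F (at s) v = v \<bullet> legendre F s" for v
  proof -
    have "frechet_derivative F (at s) v = frechet_derivative F (at s) (\<Sum>j\<in>UNIV. v $ j *\<^sub>R axis j 1)"
      by (simp add: basis_expansion scalar_mult_eq_scaleR[symmetric])
    also have "\<dots> = (\<Sum>j\<in>UNIV. v $ j *\<^sub>R frechet_derivative F (at s) (axis j 1))"
      using has_derivative_linear[OF d] by (simp add: linear_sum linear_cmul)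
    finally show ?thesis by (simp add: legendre_def inner_vec_def)
  qed
  then have "frechet_derivative F (at s) = (\<lambda>v. v \<bullet> legendre F s)" by blast
  with d show ?thesis by simp
qed

lemma legendre_eqI:
  assumes "(F has_derivative (\<lambda>v. v \<bullet> y)) (at s)"
  shows "legendre F s = y"
  unfolding legendre_def frechet_derivative_at[OF assms, symmetric] by (simp add: vec_eq_iff inner_axis')

lemma exp_point_has_derivative:
  "(exp_point has_derivative (\<lambda>v. \<Sum>j\<in>UNIV. (v $ j / 2) *\<^sub>R axis j 1)) (at 0)"
proof -
  have "exp_point = (\<lambda>s. \<Sum>j\<in>UNIV. exp (s $ j / 2) *\<^sub>R (axis j 1 :: complex^'a))"
    by (simp add: fun_eq_iff exp_point_def vec_eq_iff axis_def if_distrib[of "\<lambda>x. _ * x"] sum.delta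
        scaleR_conv_of_real[where 'a = complex] cong: if_cong)
  moreover have "((\<lambda>s :: real^'a. s $ j / 2) has_derivative (\<lambda>v. v $ j / 2)) (at 0)" for j :: 'a
    by (intro bounded_linear_imp_has_derivative bounded_linear_compose[OF bounded_linear_divide bounded_linear_vec_nth])
  then have "((\<lambda>s. \<Sum>j\<in>UNIV. exp (s $ j / 2) *\<^sub>R (axis j 1 :: complex^'a)) has_derivative
      (\<lambda>v. \<Sum>j\<in>UNIV. (v $ j / 2) *\<^sub>R axis j 1)) (at 0)"
    by (intro has_derivative_sum has_derivative_scaleR_left has_derivative_eq_rhs[OF has_derivative_exp]) auto
  ultimately show ?thesis by simp
qed

section \<open>Differentiation along an orbit\<close>

lemma chart_of_manifold:
  assumes "complex_manifold X A" "c \<in> A"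
  shows "fst c \<subseteq> topspace X" "openin X (fst c)"
    "\<And>x. x \<in> fst c \<Longrightarrow> chart_inv c (snd c x) = x"
    "continuous_map (subtopology X (fst c)) euclidean (snd c)"
proof -
  have *: "openin X (fst c)"
    "homeomorphic_map (subtopology X (fst c)) (top_of_set (snd c ` fst c)) (snd c)"
    using assms unfolding complex_manifold_def by blast+
  then show sub: "fst c \<subseteq> topspace X" and "openin X (fst c)"
    using openin_subset by auto
  have "inj_on (snd c) (fst c)"
    using homeomorphic_imp_injective_map[OF *(2)] sub by (simp add: Int_absorb1)
  then show "\<And>x. x \<in> fst c \<Longrightarrow> chart_inv c (snd c x) = x"
    unfolding chart_inv_def by (rule inv_into_f_f)
  show "continuous_map (subtopology X (fst c)) euclidean (snd c)"
    using homeomorphic_imp_continuous_map[OF *(2)] by (simp add: continuous_map_in_subtopology)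
qed

lemma smooth_fun_has_derivative:
  assumes "smooth_fun A f" "c \<in> A" "x \<in> fst c"
  shows "(f \<circ> chart_inv c) differentiable (at (snd c x))"
proof -
  have "Ck_on (Suc 0) (snd c ` fst c) (f \<circ> chart_inv c)"
    using assms unfolding smooth_fun_def smooth_on_def by blast
  then show ?thesis using assms by auto
qed

lemma torus_action_in_space:
  assumes "holomorphic_torus_action X A act" "\<zeta> \<in> complex_torus" "x \<in> topspace X"
  shows "act \<zeta> x \<in> topspace X"
proof -
  have "(\<lambda>(\<zeta>, x). act \<zeta> x) \<in> topspace (prod_topology (top_of_set complex_torus) X) \<rightarrow> topspace X"
    using assms(1) unfolding holomorphic_torus_action_def by (blast dest: continuous_map_funspace)
  from Pi_mem[OF this, of "(\<zeta>, x)"] show ?thesis using assms(2,3) by simp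
qed

text \<open>Continuity is glued together from the charts, and the manifold is compact.  This is what makes
  the two potentials differ by a bounded function only.\<close>

lemma smooth_fun_bounded:
  fixes H :: "'a \<Rightarrow> real"
  assumes "complex_manifold X A" "compact_space X" "smooth_fun A H"
  obtains B where "\<And>x. x \<in> topspace X \<Longrightarrow> \<bar>H x\<bar> \<le> B"
proof -
  have "continuous_map X euclidean H"
  proof (rule pasting_lemma[where I = A and T = fst and f = "\<lambda>_. H"])
    fix c assume c: "c \<in> A"
    have "Ck_on 0 (snd c ` fst c) (H \<circ> chart_inv c)"
      using assms(3) c unfolding smooth_fun_def smooth_on_def by blast
    then have "continuous_map (top_of_set (snd c ` fst c)) euclidean (H \<circ> chart_inv c)" by simp
    moreover have "continuous_map (subtopology X (fst c)) (top_of_set (snd c ` fst c)) (snd c)"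
      using chart_of_manifold(1,4)[OF assms(1) c] by (auto simp: continuous_map_in_subtopology)
    ultimately have "continuous_map (subtopology X (fst c)) euclidean ((H \<circ> chart_inv c) \<circ> snd c)"
      by (rule continuous_map_compose[rotated])
    then show "continuous_map (subtopology X (fst c)) euclidean H"
      by (rule continuous_map_eq) (use chart_of_manifold(3)[OF assms(1) c] in auto)
  next
    fix x assume "x \<in> topspace X"
    then show "\<exists>c. c \<in> A \<and> x \<in> fst c \<and> H x = H x"
      using assms(1) unfolding complex_manifold_def by blast
  qed (use chart_of_manifold(2)[OF assms(1)] in auto)
  then have "compactin euclidean (H ` topspace X)"
    using assms(2) image_compactin unfolding compact_space_def by blast
  then have "bounded (H ` topspace X)" by (simp add: compact_imp_bounded)
  then show ?thesis using that unfolding bounded_iff by auto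
qed

text \<open>The vector field on the manifold generated by the element \<open>v\<close> of the Lie algebra of the real
  torus.\<close>

definition infinitesimal_action ::
  "(complex^'n::finite \<Rightarrow> 'a \<Rightarrow> 'a) \<Rightarrow> real^'n \<Rightarrow> ('a, 'd::finite) chart \<Rightarrow> 'a \<Rightarrow> complex^'d" where
  "infinitesimal_action act v c x = (\<Sum>j\<in>UNIV. v $ j *\<^sub>R generator act j c x)"

lemma scaleR_eq_vector_scalar_mult: "a *\<^sub>R x = complex_of_real a *s (x :: complex^'d::finite)"
  by (simp add: vec_eq_iff scaleR_conv_of_real[where 'a = complex])

text \<open>The derivative of the orbit map at the unit is complex linear.  The generator in the direction
  \<open>v\<close> is its value at \<open>\<i> *s v\<close>, since rotations move in the imaginary direction, while the curve
  \<open>exp_point\<close> moves in the real direction \<open>v / 2\<close>.  This accounts for the factor \<open>- \<i> / 2\<close>.\<close>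

lemma orbit_map_has_derivative:
  fixes act :: "complex^'n::finite \<Rightarrow> 'a \<Rightarrow> 'a" and A :: "('a, 'd::finite) chart set"
  assumes M: "complex_manifold X A" and T: "holomorphic_torus_action X A act"
    and c: "c \<in> A" "x \<in> fst c"
  shows "((\<lambda>w. snd c (act (exp_point w) x)) has_derivative
    (\<lambda>v. (- \<i> / 2) *s infinitesimal_action act v c x)) (at 0)"
proof -
  note ch = chart_of_manifold[OF M c(1)]
  have one: "1 \<in> (complex_torus :: (complex^'n) set)" by (simp add: complex_torus_def)
  have "act 1 x = x" using T c(2) ch(1) unfolding holomorphic_torus_action_def by blast
  then have "\<exists>D. ((\<lambda>(\<eta>, y). snd c (act \<eta> (chart_inv c y))) has_derivative D) (at (1, snd c x)) \<and>
      (\<forall>a u v. D (a *s u, a *s v) = a *s D (u, v))"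
    using T c one unfolding holomorphic_torus_action_def by simp
  then obtain D where
    D: "((\<lambda>(\<eta>, y). snd c (act \<eta> (chart_inv c y))) has_derivative D) (at (1, snd c x))"
      "\<And>a u v. D (a *s u, a *s v) = a *s D (u, v)"
    by blast
  define E where "E u = D (u, 0)" for u
  have "((\<lambda>\<eta>. (\<eta>, snd c x)) has_derivative (\<lambda>u. (u, 0))) (at 1)"
    by (auto intro!: derivative_eq_intros)
  from has_derivative_compose[OF this D(1)]
  have E: "((\<lambda>\<eta>. snd c (act \<eta> x)) has_derivative E) (at 1)"
    by (simp add: E_def[abs_def] ch(3)[OF c(2)])
  have E_lin: "linear E" using has_derivative_linear[OF E] .
  have E_cmul: "E (a *s u) = a *s E u" for a u
    using D(2)[of a u 0] by (simp add: E_def)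
  have gen: "generator act j c x = \<i> *s E (axis j 1)" for j
  proof -
    define rot :: "real \<Rightarrow> complex^'n" where "rot \<theta> = (\<chi> k. if k = j then cis \<theta> else 1)" for \<theta>
    \<comment> \<open>Splitting off the real and imaginary parts makes the curve differentiable term by term.\<close>
    have rot: "rot = (\<lambda>\<theta>. (1 - axis j 1) + cos \<theta> *\<^sub>R axis j 1 + sin \<theta> *\<^sub>R axis j \<i>)"
      by (auto simp: rot_def fun_eq_iff vec_eq_iff axis_def complex_eq_iff)
    have "(rot has_derivative (\<lambda>t. t *\<^sub>R axis j \<i>)) (at 0)"
      unfolding rot by (auto intro!: derivative_eq_intros)
    moreover have "rot 0 = 1" by (simp add: rot_def vec_eq_iff)
    ultimately have "((\<lambda>\<theta>. snd c (act (rot \<theta>) x)) has_derivative (\<lambda>t. E (t *\<^sub>R axis j \<i>))) (at 0)"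
      using has_derivative_compose[of rot _ 0 UNIV "\<lambda>\<eta>. snd c (act \<eta> x)" E] E by simp
    then have "((\<lambda>\<theta>. snd c (act (rot \<theta>) x)) has_vector_derivative E (axis j \<i>)) (at 0)"
      by (simp add: has_vector_derivative_def linear_cmul[OF E_lin])
    then have "generator act j c x = E (axis j \<i>)"
      unfolding generator_def rot_def by (rule vector_derivative_at)
    also have "axis j \<i> = \<i> *s (axis j 1 :: complex^'n)" by (simp add: vec_eq_iff axis_def)
    finally show ?thesis by (simp add: E_cmul)
  qed
  have "((\<lambda>w. snd c (act (exp_point w) x)) has_derivative
      (\<lambda>v. E (\<Sum>j\<in>UNIV. (v $ j / 2) *\<^sub>R axis j 1))) (at 0)"
    using has_derivative_compose[OF exp_point_has_derivative, of "\<lambda>\<eta>. snd c (act \<eta> x)" E] E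
    by (simp add: exp_point_0)
  moreover have "E (\<Sum>j\<in>UNIV. (v $ j / 2) *\<^sub>R axis j 1) = (- \<i> / 2) *s infinitesimal_action act v c x" for v
    unfolding infinitesimal_action_def gen
    by (simp add: linear_sum[OF E_lin] linear_cmul[OF E_lin] vec_eq_iff sum_distrib_left
        scaleR_conv_of_real[where 'a = complex] flip: sum_negf) (simp add: algebra_simps)
  ultimately show ?thesis by simp
qed

text \<open>By the group law, the orbit curve near \<open>s\<close> is the orbit curve of \<open>x\<close> near the origin, so one
  chart at \<open>x\<close> suffices and the derivative at the unit applies.\<close>

lemma along_orbit_has_derivative:
  fixes act :: "complex^'n::finite \<Rightarrow> 'a \<Rightarrow> 'a" and A :: "('a, 'd::finite) chart set"
  assumes M: "complex_manifold X A" and T: "holomorphic_torus_action X A act"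
    and q: "q \<in> topspace X" and x: "x = act (exp_point s) q" and c: "c \<in> A" "x \<in> fst c"
    and f: "((f \<circ> chart_inv c) has_derivative f') (at (snd c x))"
  shows "((\<lambda>s. f (act (exp_point s) q)) has_derivative
    (\<lambda>v. f' ((- \<i> / 2) *s infinitesimal_action act v c x))) (at s)"
proof -
  note ch = chart_of_manifold[OF M c(1)]
  have xX: "x \<in> topspace X" using ch(1) c(2) by blast
  have act1: "act 1 x = x" using T xX unfolding holomorphic_torus_action_def by blast
  have shift: "act (exp_point u) q = act (exp_point (u - s)) x" for u
  proof -
    have "act (exp_point (u - s) * exp_point s) q = act (exp_point (u - s)) x"
      using T q exp_point_in_torus unfolding holomorphic_torus_action_def x by blast
    then show ?thesis by (simp flip: exp_point_add)
  qed
  have "((\<lambda>w. (f \<circ> chart_inv c) (snd c (act (exp_point w) x))) has_derivative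
      (\<lambda>v. f' ((- \<i> / 2) *s infinitesimal_action act v c x))) (at 0)"
    using has_derivative_compose[OF orbit_map_has_derivative[OF M T c], of "f \<circ> chart_inv c" f'] f
    by (simp add: exp_point_0 act1)
  \<comment> \<open>The chart only inverts on its domain,
    which the orbit curve does not leave for small \<open>w\<close>.\<close>
  moreover have "eventually (\<lambda>w. (f \<circ> chart_inv c) (snd c (act (exp_point w) x)) = f (act (exp_point w) x)) (at 0)"
  proof -
    have "continuous_map (top_of_set complex_torus) (prod_topology (top_of_set complex_torus) X) (\<lambda>\<eta>. (\<eta>, x))"
      using xX by (simp add: continuous_map_pairwise o_def)
    moreover have "continuous_map (prod_topology (top_of_set complex_torus) X) X (\<lambda>(\<zeta>, x). act \<zeta> x)"
      using T unfolding holomorphic_torus_action_def by blast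
    ultimately have "continuous_map (top_of_set complex_torus) X ((\<lambda>(\<zeta>, x). act \<zeta> x) \<circ> (\<lambda>\<eta>. (\<eta>, x)))"
      by (rule continuous_map_compose)
    moreover have "continuous_map euclidean (top_of_set complex_torus) (exp_point :: real^'n \<Rightarrow> _)"
      unfolding exp_point_def
      by (auto simp: continuous_map_in_subtopology complex_torus_def intro!: continuous_intros)
    ultimately have "continuous_map euclidean X (((\<lambda>(\<zeta>, x). act \<zeta> x) \<circ> (\<lambda>\<eta>. (\<eta>, x))) \<circ> exp_point)"
      by (rule continuous_map_compose[rotated])
    then have "open {w. act (exp_point w) x \<in> fst c}"
      using openin_continuous_map_preimage[OF _ ch(2)] by fastforce
    moreover have "0 \<in> {w. act (exp_point w) x \<in> fst c}"
      using c(2) by (simp add: exp_point_0 act1)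
    ultimately have "eventually (\<lambda>w. w \<in> {w. act (exp_point w) x \<in> fst c}) (at 0)"
      by (intro eventually_at_in_open')
    then show ?thesis by eventually_elim (simp add: ch(3))
  qed
  ultimately have "((\<lambda>w. f (act (exp_point w) x)) has_derivative
      (\<lambda>v. f' ((- \<i> / 2) *s infinitesimal_action act v c x))) (at 0)"
    by (rule has_derivative_transform_eventually) (simp_all add: exp_point_0 act1 ch(3) c(2))
  moreover have "((\<lambda>u. u - s) has_derivative (\<lambda>v. v)) (at s)" by (auto intro!: derivative_eq_intros)
  ultimately have "((\<lambda>u. f (act (exp_point (u - s)) x)) has_derivative
      (\<lambda>v. f' ((- \<i> / 2) *s infinitesimal_action act v c x))) (at s)"
    using has_derivative_compose[of "\<lambda>u. u - s" "\<lambda>v. v" s UNIV "\<lambda>w. f (act (exp_point w) x)"]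
    by simp
  then show ?thesis by (simp add: shift)
qed

section \<open>Orbits in projective space\<close>

text \<open>The weights of the action in the affine chart \<open>cp_dom r\<close>: dividing by the homogeneous coordinate
  of index \<open>r\<close> subtracts its weight.\<close>

definition relative_weight :: "('N::finite option \<Rightarrow> int^'n) \<Rightarrow> 'N option \<Rightarrow> 'N option \<Rightarrow> real^'n" where
  "relative_weight \<beta> r k = (\<chi> j. of_int (\<beta> k $ j - \<beta> r $ j))"

lemma cp_point_self: "a \<in> cp_point a"
  by (auto simp: cp_point_def intro!: exI[of _ 1])

lemma cp_point_scale:
  assumes "k \<noteq> 0"
  shows "cp_point (k *s a) = cp_point a"
proof -
  have "cp_point (k *s a) \<subseteq> cp_point a" if "k \<noteq> 0" for k and a :: "complex^('b::finite option)"
    using that by (auto simp: cp_point_def)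
  from this[of k a] this[of "inverse k" "k *s a"] show ?thesis using assms by auto
qed

lemma cp_dom_normalized:
  assumes "p \<in> cp_dom r"
  obtains a where "a $ r = 1" "p = cp_point a"
proof -
  obtain b where b: "p = cp_point b" using assms by (auto simp: cp_dom_def cp_carrier_def)
  then have "b $ r \<noteq> 0" using assms cp_point_self[of b] by (auto simp: cp_dom_def)
  then have "(inverse (b $ r) *s b) $ r = 1" "p = cp_point (inverse (b $ r) *s b)"
    using b by (simp_all add: cp_point_scale)
  then show ?thesis by (rule that)
qed

lemma cp_point_in_cp_dom:
  assumes "b $ r \<noteq> 0"
  shows "cp_point b \<in> cp_dom r"
proof -
  have "b \<noteq> 0" using assms by auto
  then show ?thesis using assms by (auto simp: cp_dom_def cp_carrier_def cp_point_def)
qed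

lemma cp_coord_point:
  "cp_coord r (cp_point b) $ j = b $ (if Some j = r then None else Some j) / b $ r"
proof -
  have "(SOME a. a \<in> cp_point b) \<in> cp_point b"
    by (rule someI[of _ b]) (rule cp_point_self)
  then obtain k where "k \<noteq> 0" "(SOME a. a \<in> cp_point b) = k *s b" by (auto simp: cp_point_def)
  then show ?thesis by (simp add: cp_coord_def Let_def)
qed

lemma cp_action_exp_point:
  "cp_action \<beta> (exp_point s) (cp_point a) =
    cp_point (\<chi> k. complex_of_real (exp ((\<Sum>j\<in>UNIV. of_int (\<beta> k $ j) * s $ j) / 2)) * a $ k)"
proof -
  have m: "(\<Prod>j\<in>UNIV. (exp_point s $ j) powi (\<beta> k $ j)) =
      complex_of_real (exp ((\<Sum>j\<in>UNIV. of_int (\<beta> k $ j) * s $ j) / 2))" for k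
  proof -
    have "(exp_point s $ j) powi (\<beta> k $ j) = complex_of_real (exp (of_int (\<beta> k $ j) * s $ j / 2))" for j
      by (simp add: exp_point_def exp_power_int flip: of_real_power_int exp_of_real)
    then show ?thesis by (simp add: exp_sum sum_divide_distrib)
  qed
  show ?thesis
    unfolding cp_action_def m
  proof (intro set_eqI iffI)
    fix y
    assume "y \<in> cp_point (\<chi> k. complex_of_real (exp ((\<Sum>j\<in>UNIV. of_int (\<beta> k $ j) * s $ j) / 2)) * a $ k)"
    then obtain c where "c \<noteq> 0" and y:
      "y = c *s (\<chi> k. complex_of_real (exp ((\<Sum>j\<in>UNIV. of_int (\<beta> k $ j) * s $ j) / 2)) * a $ k)"
      by (auto simp: cp_point_def)
    then have "c *s a \<in> cp_point a" by (auto simp: cp_point_def)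
    then show "y \<in> (\<lambda>a. \<chi> k. complex_of_real (exp ((\<Sum>j\<in>UNIV. of_int (\<beta> k $ j) * s $ j) / 2)) * a $ k) ` cp_point a"
      by (rule rev_image_eqI) (simp add: y vec_eq_iff)
  qed (auto simp: cp_point_def vec_eq_iff)
qed

lemma cp_orbit_in_affine_chart:
  assumes "a $ r = 1"
  shows "cp_action \<beta> (exp_point s) (cp_point a) \<in> cp_dom r"
    and "cp_coord r (cp_action \<beta> (exp_point s) (cp_point a)) $ j =
      (let k = if Some j = r then None else Some j
       in a $ k * complex_of_real (exp ((relative_weight \<beta> r k \<bullet> s) / 2)))"
proof -
  show "cp_action \<beta> (exp_point s) (cp_point a) \<in> cp_dom r"
    unfolding cp_action_exp_point by (rule cp_point_in_cp_dom) (simp add: assms)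
  have "relative_weight \<beta> r k \<bullet> s =
      (\<Sum>j\<in>UNIV. of_int (\<beta> k $ j) * s $ j) - (\<Sum>j\<in>UNIV. of_int (\<beta> r $ j) * s $ j)" for k
    by (simp add: relative_weight_def inner_vec_def left_diff_distrib sum_subtractf)
  then show "cp_coord r (cp_action \<beta> (exp_point s) (cp_point a)) $ j =
      (let k = if Some j = r then None else Some j
       in a $ k * complex_of_real (exp ((relative_weight \<beta> r k \<bullet> s) / 2)))"
    by (simp add: cp_action_exp_point cp_coord_point assms Let_def diff_divide_distrib exp_diff)
qed

lemma orbit_restriction_eq_log_exp_sum:
  assumes "a $ r = 1"
  shows "orbit_restriction (cp_action \<beta>) (cp_potential r) (cp_point a) =
    log_exp_sum {k. a $ k \<noteq> 0} (\<lambda>k. (cmod (a $ k))\<^sup>2) (relative_weight \<beta> r)"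
proof
  fix s
  have "(\<Sum>k\<in>UNIV. (cmod (a $ k))\<^sup>2 * exp (relative_weight \<beta> r k \<bullet> s)) =
      (\<Sum>k\<in>{k. a $ k \<noteq> 0}. (cmod (a $ k))\<^sup>2 * exp (relative_weight \<beta> r k \<bullet> s))"
    by (rule sum.mono_neutral_right) auto
  then show "orbit_restriction (cp_action \<beta>) (cp_potential r) (cp_point a) s =
    log_exp_sum {k. a $ k \<noteq> 0} (\<lambda>k. (cmod (a $ k))\<^sup>2) (relative_weight \<beta> r) s"
    by (simp add: orbit_restriction_cp_potential[OF assms] log_exp_sum_def relative_weight_def
        inner_vec_def)
qed

section \<open>The moment map is monotone along an orbit\<close>

text \<open>The embedding detects that the orbit moves: in the affine chart the coordinate \<open>k\<close> of the image
  is \<open>a $ k * exp (\<alpha> k \<bullet> s / 2)\<close>, whose derivative in the direction \<open>v\<close> is nonzero, whereas by the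
  chain rule it would vanish together with the infinitesimal action.\<close>

lemma infinitesimal_action_nonzero:
  fixes act :: "complex^'n::finite \<Rightarrow> 'a \<Rightarrow> 'a" and A :: "('a, 'd::finite) chart set"
    and \<gamma> :: "'a \<Rightarrow> 'N::finite cp"
  assumes M: "complex_manifold X A" and T: "holomorphic_torus_action X A act"
    and \<gamma>: "holomorphic_map X A cp_topology cp_atlas \<gamma>"
    and equivariant: "\<forall>\<zeta>\<in>complex_torus. \<forall>x\<in>topspace X. \<gamma> (act \<zeta> x) = cp_action \<beta> \<zeta> (\<gamma> x)"
    and q: "q \<in> topspace X" and x: "x = act (exp_point s) q" and c: "c \<in> A" "x \<in> fst c"
    and a: "\<gamma> q = cp_point a" "a $ r = 1"
    and k: "a $ k \<noteq> 0" "v \<bullet> relative_weight \<beta> r k \<noteq> 0"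
  shows "infinitesimal_action act v c x \<noteq> 0"
proof
  assume zero: "infinitesimal_action act v c x = 0"
  have \<gamma>_orbit: "\<gamma> (act (exp_point u) q) = cp_action \<beta> (exp_point u) (cp_point a)" for u
    using equivariant q a(1) exp_point_in_torus by metis
  have "(cp_dom r, cp_coord r) \<in> cp_atlas" by (simp add: cp_atlas_def)
  then have "cholomorphic_on (cp_coord r \<circ> \<gamma> \<circ> chart_inv c) (snd c ` {x \<in> fst c. \<gamma> x \<in> cp_dom r})"
    using \<gamma> c(1) unfolding holomorphic_map_def by fastforce
  moreover have "\<gamma> x \<in> cp_dom r"
    unfolding x \<gamma>_orbit by (rule cp_orbit_in_affine_chart(1)[where a = a, OF a(2)])
  ultimately obtain D where D: "(cp_coord r \<circ> \<gamma> \<circ> chart_inv c has_derivative D) (at (snd c x))"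
    using c(2) unfolding cholomorphic_on_def by blast
  have "k \<noteq> r" using k(2) by (auto simp: relative_weight_def inner_vec_def)
  \<comment> \<open>Every homogeneous index except \<open>r\<close> has a slot among the affine coordinates.\<close>
  obtain j where j: "k = (if Some j = r then None else Some j)"
  proof (cases k)
    case None
    then obtain j where "r = Some j" using \<open>k \<noteq> r\<close> by (cases r) auto
    then show ?thesis using that[of j] None by simp
  next
    case (Some j)
    then show ?thesis using that[of j] \<open>k \<noteq> r\<close> by auto
  qed
  have "((\<lambda>s. (cp_coord r \<circ> \<gamma>) (act (exp_point s) q)) has_derivative
      (\<lambda>v. D ((- \<i> / 2) *s infinitesimal_action act v c x))) (at s)"
    by (rule along_orbit_has_derivative[OF M T q x c D])
  then have "((\<lambda>s. (cp_coord r \<circ> \<gamma>) (act (exp_point s) q) $ j) has_derivative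
      (\<lambda>v. D ((- \<i> / 2) *s infinitesimal_action act v c x) $ j)) (at s)"
    by (rule bounded_linear.has_derivative[OF bounded_linear_vec_nth])
  moreover have "(cp_coord r \<circ> \<gamma>) (act (exp_point u) q) $ j =
      a $ k * complex_of_real (exp ((relative_weight \<beta> r k \<bullet> u) / 2))" for u
    using cp_orbit_in_affine_chart(2)[where a = a, OF a(2), of \<beta> u j] by (simp add: \<gamma>_orbit j Let_def)
  ultimately have 1: "((\<lambda>u. a $ k * complex_of_real (exp ((relative_weight \<beta> r k \<bullet> u) / 2))) has_derivative
      (\<lambda>v. D ((- \<i> / 2) *s infinitesimal_action act v c x) $ j)) (at s)"
    by simp
  have half: "((\<lambda>u. (relative_weight \<beta> r k \<bullet> u) / 2) has_derivative
      (\<lambda>v. (relative_weight \<beta> r k \<bullet> v) / 2)) (at s)"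
    by (intro bounded_linear_imp_has_derivative
        bounded_linear_compose[of "\<lambda>t. t / 2", OF bounded_linear_divide bounded_linear_inner_right])
  have 2: "((\<lambda>u. a $ k * complex_of_real (exp ((relative_weight \<beta> r k \<bullet> u) / 2))) has_derivative
      (\<lambda>v. a $ k * complex_of_real (exp ((relative_weight \<beta> r k \<bullet> s) / 2) *
         ((relative_weight \<beta> r k \<bullet> v) / 2)))) (at s)"
    by (intro has_derivative_mult_right has_derivative_of_real has_derivative_eq_rhs[OF has_derivative_exp[OF half]])
       (simp add: mult.commute)
  have "D ((- \<i> / 2) *s infinitesimal_action act v c x) $ j = 0"
    by (simp add: zero linear_0[OF has_derivative_linear[OF D]])
  then show False
    using fun_cong[OF has_derivative_unique[OF 1 2], of v] k by (simp add: inner_commute)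
qed

text \<open>The defining identity of the moment map, evaluated on the tangent vector \<open>- \<i> / 2\<close> times the
  generator, turns the derivative into the Kaehler metric, up to the factor \<open>1 / 2\<close>.\<close>

lemma moment_map_along_orbit:
  fixes act :: "complex^'n::finite \<Rightarrow> 'a \<Rightarrow> 'a" and A :: "('a, 'd::finite) chart set"
  assumes M: "complex_manifold X A" and T: "holomorphic_torus_action X A act"
    and form: "two_form A \<omega>" and \<Phi>: "moment_map X A \<omega> act \<Phi>"
    and q: "q \<in> topspace X" and x: "x = act (exp_point s) q" and c: "c \<in> A" "x \<in> fst c"
  shows "((\<lambda>s. v \<bullet> \<Phi> (act (exp_point s) q)) has_derivative
    (\<lambda>u. \<omega> c x (infinitesimal_action act v c x) (\<i> *s infinitesimal_action act u c x) / 2)) (at s)"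
proof -
  define \<xi> where "\<xi> = infinitesimal_action act v c x"
  have bil: "bilinear (\<omega> c x)" using form c unfolding two_form_def by blast
  have comp: "((\<lambda>y. \<Phi> (chart_inv c y) $ j) has_derivative (\<lambda>u. - \<omega> c x (generator act j c x) u)) (at (snd c x))" for j
  proof -
    have "smooth_fun A \<Phi>" using \<Phi> by (simp add: moment_map_def)
    from smooth_fun_has_derivative[OF this c]
    obtain D where "(\<Phi> \<circ> chart_inv c has_derivative D) (at (snd c x))"
      unfolding differentiable_def by (rule exE)
    from bounded_linear.has_derivative[OF bounded_linear_vec_nth this, of j]
    have "(\<lambda>y. \<Phi> (chart_inv c y) $ j) differentiable (at (snd c x))"
      unfolding differentiable_def o_def by (rule exI[of _ "\<lambda>u. D u $ j"])
    moreover have "frechet_derivative (\<lambda>y. \<Phi> (chart_inv c y) $ j) (at (snd c x)) =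
        (\<lambda>u. - \<omega> c x (generator act j c x) u)"
      using \<Phi> c by (simp add: moment_map_def fun_eq_iff)
    ultimately show ?thesis by (simp add: frechet_derivative_works)
  qed
  have "((\<lambda>y. \<Sum>j\<in>UNIV. v $ j * \<Phi> (chart_inv c y) $ j) has_derivative
      (\<lambda>u. \<Sum>j\<in>UNIV. v $ j * (- \<omega> c x (generator act j c x) u))) (at (snd c x))"
    by (intro has_derivative_sum has_derivative_mult_right comp)
  moreover have "(\<Sum>j\<in>UNIV. v $ j * (- \<omega> c x (generator act j c x) u)) = - \<omega> c x \<xi> u" for u
  proof -
    have lin: "linear (\<lambda>z. \<omega> c x z u)" using bil unfolding bilinear_def by blast
    show ?thesis
      by (simp add: \<xi>_def infinitesimal_action_def linear_sum[OF lin] linear_cmul[OF lin] sum_negf)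
  qed
  ultimately have "(((\<lambda>y. v \<bullet> \<Phi> y) \<circ> chart_inv c) has_derivative (\<lambda>u. - \<omega> c x \<xi> u)) (at (snd c x))"
    by (simp add: inner_vec_def o_def)
  from along_orbit_has_derivative[OF M T q x c this]
  have "((\<lambda>s. v \<bullet> \<Phi> (act (exp_point s) q)) has_derivative
    (\<lambda>u. - \<omega> c x \<xi> ((- \<i> / 2) *s infinitesimal_action act u c x))) (at s)" .
  moreover have "- \<omega> c x \<xi> ((- \<i> / 2) *s z) = \<omega> c x \<xi> (\<i> *s z) / 2" for z
  proof -
    have lin: "linear (\<omega> c x \<xi>)" using bil unfolding bilinear_def by blast
    have "(- \<i> / 2) *s z = (- 1 / 2) *\<^sub>R (\<i> *s z)"
      by (simp add: scaleR_eq_vector_scalar_mult)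
    then show ?thesis by (simp only: linear_cmul[OF lin]) simp
  qed
  ultimately show ?thesis by (simp only: \<xi>_def)
qed

text \<open>The derivative of the component \<open>v\<close> of the moment map in its own direction is half the squared
  Kaehler length of the infinitesimal action of \<open>v\<close>.  This is the convexity of the potential on the
  orbit, and strict convexity in the directions that move the points of the orbit.\<close>

lemma moment_map_monotone_along_orbit:
  fixes act :: "complex^'n::finite \<Rightarrow> 'a \<Rightarrow> 'a" and A :: "('a, 'd::finite) chart set"
  assumes M: "complex_manifold X A" and T: "holomorphic_torus_action X A act"
    and form: "kaehler_form A \<omega>" and \<Phi>: "moment_map X A \<omega> act \<Phi>"
    and q: "q \<in> topspace X"
  shows "v \<bullet> \<Phi> (act (exp_point s) q) \<le> v \<bullet> \<Phi> (act (exp_point (s + v)) q)"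
    and "(\<And>t c. c \<in> A \<Longrightarrow> act (exp_point t) q \<in> fst c \<Longrightarrow>
        infinitesimal_action act v c (act (exp_point t) q) \<noteq> 0) \<Longrightarrow>
      v \<bullet> \<Phi> (act (exp_point s) q) < v \<bullet> \<Phi> (act (exp_point (s + v)) q)"
proof -
  define \<phi> where "\<phi> t = v \<bullet> \<Phi> (act (exp_point (s + t *\<^sub>R v)) q)" for t
  have two: "two_form A \<omega>" using form by (simp add: kaehler_form_def)
  have deriv: "\<exists>c d. c \<in> A \<and> x \<in> fst c \<and> (\<phi> has_real_derivative d) (at t) \<and> d \<ge> 0 \<and>
      (infinitesimal_action act v c x \<noteq> 0 \<longrightarrow> d > 0)"
    if x: "x = act (exp_point (s + t *\<^sub>R v)) q" for t x
  proof -
    have "x \<in> topspace X" unfolding x by (rule torus_action_in_space[OF T exp_point_in_torus q])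
    then obtain c where c: "c \<in> A" "x \<in> fst c" using M unfolding complex_manifold_def by blast
    define \<xi> where "\<xi> = infinitesimal_action act v c x"
    have bil: "bilinear (\<omega> c x)" using two c unfolding two_form_def by blast
    have "linear (\<lambda>z. infinitesimal_action act z c x)"
      by (rule linearI)
         (simp_all add: infinitesimal_action_def scaleR_add_left sum.distrib scaleR_sum_right)
    from linear_cmul[OF this] have hom: "infinitesimal_action act (h *\<^sub>R v) c x = h *\<^sub>R \<xi>" for h
      by (simp add: \<xi>_def)
    have "((\<lambda>t. s + t *\<^sub>R v) has_derivative (\<lambda>h. h *\<^sub>R v)) (at t)"
      by (auto intro!: derivative_eq_intros)
    from has_derivative_compose[OF this moment_map_along_orbit[OF M T two \<Phi> q x c, where v = v]]
    have "(\<phi> has_derivative (\<lambda>h. \<omega> c x \<xi> (\<i> *s (h *\<^sub>R \<xi>)) / 2)) (at t)"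
      by (simp add: \<phi>_def[abs_def] hom flip: \<xi>_def)
    moreover have "\<omega> c x \<xi> (\<i> *s (h *\<^sub>R \<xi>)) / 2 = \<omega> c x \<xi> (\<i> *s \<xi>) / 2 * h" for h
    proof -
      have lin: "linear (\<omega> c x \<xi>)" using bil unfolding bilinear_def by blast
      have "\<i> *s (h *\<^sub>R \<xi>) = h *\<^sub>R (\<i> *s \<xi>)" by (simp add: scaleR_eq_vector_scalar_mult mult.commute)
      then show ?thesis by (simp add: linear_cmul[OF lin])
    qed
    ultimately have "(\<phi> has_real_derivative \<omega> c x \<xi> (\<i> *s \<xi>) / 2) (at t)"
      by (simp only: has_field_derivative_def)
    moreover have "\<xi> \<noteq> 0 \<Longrightarrow> \<omega> c x \<xi> (\<i> *s \<xi>) > 0"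
      using bspec[OF bspec[OF form[unfolded kaehler_form_def, THEN conjunct2, THEN conjunct2] c(1)] c(2)]
      by blast
    moreover from calculation(2) have "\<omega> c x \<xi> (\<i> *s \<xi>) / 2 \<ge> 0"
      by (cases "\<xi> = 0") (simp_all add: bilinear_lzero[OF bil] less_imp_le)
    ultimately show ?thesis
      using c unfolding \<xi>_def by (metis half_gt_zero)
  qed
  have "\<exists>d. (\<phi> has_real_derivative d) (at t) \<and> d \<ge> 0" for t using deriv[OF refl, of t] by blast
  then have "\<phi> 0 \<le> \<phi> 1" by (intro DERIV_nonneg_imp_nondecreasing[of 0 1 \<phi>]) simp_all
  then show "v \<bullet> \<Phi> (act (exp_point s) q) \<le> v \<bullet> \<Phi> (act (exp_point (s + v)) q)"
    by (simp add: \<phi>_def)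
  assume "\<And>t c. c \<in> A \<Longrightarrow> act (exp_point t) q \<in> fst c \<Longrightarrow>
        infinitesimal_action act v c (act (exp_point t) q) \<noteq> 0"
  then have "\<exists>d. (\<phi> has_real_derivative d) (at t) \<and> d > 0" for t
    using deriv[OF refl, of t] by blast
  then have "\<phi> 0 < \<phi> 1" by (intro DERIV_pos_imp_increasing[of 0 1 \<phi>]) simp_all
  then show "v \<bullet> \<Phi> (act (exp_point s) q) < v \<bullet> \<Phi> (act (exp_point (s + v)) q)"
    by (simp add: \<phi>_def)
qed

lemma orbit_restriction_differentiable:
  fixes act :: "complex^'n::finite \<Rightarrow> 'a \<Rightarrow> 'a" and A :: "('a, 'd::finite) chart set"
  assumes M: "complex_manifold X A" and T: "holomorphic_torus_action X A act"
    and H: "smooth_fun A H" and q: "q \<in> topspace X"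
  shows "orbit_restriction act H q differentiable (at s)"
proof -
  have "act (exp_point s) q \<in> topspace X"
    by (rule torus_action_in_space[OF T exp_point_in_torus q])
  then obtain c where c: "c \<in> A" "act (exp_point s) q \<in> fst c"
    using M unfolding complex_manifold_def by blast
  then obtain D where "((H \<circ> chart_inv c) has_derivative D) (at (snd c (act (exp_point s) q)))"
    using smooth_fun_has_derivative[OF H] unfolding differentiable_def by blast
  from along_orbit_has_derivative[OF M T q refl c this]
  show "orbit_restriction act H q differentiable (at s)"
    unfolding differentiable_def orbit_restriction_def[abs_def] exp_point_def by blast
qed

section \<open>Equality of the moment images\<close>

theorem theorem10p2:
  fixes X :: "'a topology" and A :: "('a, 'd::finite) chart set" and \<omega> :: "('a, 'd) form2"
    and act :: "complex^'n::finite \<Rightarrow> 'a \<Rightarrow> 'a"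
    and \<beta> :: "'N::finite option \<Rightarrow> int^'n" and \<gamma> :: "'a \<Rightarrow> 'N cp"
    and H :: "'a \<Rightarrow> real" and \<Phi> :: "'a \<Rightarrow> real^'n" and \<Psi> :: "'N cp \<Rightarrow> real^'n"
    and q :: 'a and p :: "'N cp" and r :: "'N option" and F F1 :: "real^'n \<Rightarrow> real"
  assumes "complex_manifold X A" and "compact_space X"
    and "kaehler_form A \<omega>"
    and "holomorphic_torus_action X A act"
    and "moment_map X A \<omega> act \<Phi>"
    and "holomorphic_embedding X A cp_topology cp_atlas \<gamma>"
    and "\<forall>\<zeta>\<in>complex_torus. \<forall>x\<in>topspace X. \<gamma> (act \<zeta> x) = cp_action \<beta> \<zeta> (\<gamma> x)"
    and "smooth_fun A H"
    and "\<forall>t\<in>real_torus. \<forall>x\<in>topspace X. H (act t x) = H x"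
    and "\<forall>c\<in>A. \<forall>x\<in>fst c. \<forall>u v.
           \<omega> c x u v = pullback_form2 cp_atlas \<gamma> fubini_study c x u v + i_ddbar_form H c x u v"
    and "moment_map cp_topology cp_atlas fubini_study (cp_action \<beta>) \<Psi>"
    and "q \<in> topspace X" and "p = \<gamma> q" and "p \<in> cp_dom r"
    and "F = orbit_restriction (cp_action \<beta>) (cp_potential r) p"
    and "F1 = (\<lambda>s. orbit_restriction act H q s + F s)"
    and "determined_by_potential (cp_action \<beta>) \<Psi> p F"
    and "determined_by_potential act \<Phi> q F1"
  shows "\<Phi> ` orbit act q = \<Psi> ` orbit (cp_action \<beta>) p \<and>
    (\<exists>P. polytope P \<and> \<Phi> ` orbit act q = rel_interior P)"
proof -
  note M = assms(1) and T = assms(4) and q = assms(12)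
  obtain a where a: "a $ r = 1" "p = cp_point a" using assms(14) by (rule cp_dom_normalized)
  define K where "K = {k. a $ k \<noteq> 0}"
  define c where "c k = (cmod (a $ k))\<^sup>2" for k
  define \<alpha> where "\<alpha> = relative_weight \<beta> r"
  define P where "P = convex hull (\<alpha> ` K)"
  have "r \<in> K" using a(1) by (simp add: K_def)
  then have K: "finite K" "K \<noteq> {}" "\<And>k. k \<in> K \<Longrightarrow> c k > 0" by (auto simp: K_def c_def)
  have F: "F = log_exp_sum K c \<alpha>"
    unfolding assms(15) a(2) K_def c_def \<alpha>_def by (rule orbit_restriction_eq_log_exp_sum[OF a(1)])
  have F_deriv: "legendre F s \<in> rel_interior P" "(F has_derivative (\<lambda>v. v \<bullet> legendre F s)) (at s)" for s
    using log_exp_sum_has_derivative[where c = c and \<alpha> = \<alpha>, OF K, of s] legendre_eqI[of F _ s]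
    by (auto simp: F P_def)
  have "F1 differentiable (at s)" for s
    unfolding assms(16)
    using orbit_restriction_differentiable[OF M T assms(8) q] F_deriv(2)
    by (intro differentiable_add) (auto simp: differentiable_def)
  then have F1_deriv: "(F1 has_derivative (\<lambda>v. v \<bullet> legendre F1 s)) (at s)" for s
    by (rule has_derivative_legendre)
  obtain B where "\<And>x. x \<in> topspace X \<Longrightarrow> \<bar>H x\<bar> \<le> B"
    using smooth_fun_bounded[OF M assms(2,8)] by blast
  then have bounded: "\<bar>F1 s - log_exp_sum K c \<alpha> s\<bar> \<le> B" for s
    using torus_action_in_space[OF T exp_point_in_torus q]
    by (simp add: assms(16) F orbit_restriction_def exp_point_def)
  have \<Phi>: "\<Phi> (act (exp_point s) q) = legendre F1 s" for s
    using assms(18) exp_point_in_torus[of s]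
    by (simp add: determined_by_potential_def log_coords_exp_point)
  have mono: "v \<bullet> legendre F1 s \<le> v \<bullet> legendre F1 (s + v)" for s v
    using moment_map_monotone_along_orbit(1)[OF M T assms(3,5) q] by (simp add: \<Phi>)
  have strict: "v \<bullet> legendre F1 s < v \<bullet> legendre F1 (s + v)"
    if kl: "k \<in> K" "l \<in> K" "v \<bullet> \<alpha> k \<noteq> v \<bullet> \<alpha> l" for s v k l
  proof -
    \<comment> \<open>The weight of one of the two coordinates does not vanish on \<open>v\<close>,
        which is all that moving the orbit takes.\<close>
    obtain m where "m \<in> K" "v \<bullet> \<alpha> m \<noteq> 0" using kl by metis
    then have "infinitesimal_action act v d (act (exp_point t) q) \<noteq> 0"
      if "d \<in> A" "act (exp_point t) q \<in> fst d" for t d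
      using that assms(6,7,13) a
      by (intro infinitesimal_action_nonzero[OF M T _ _ q refl, where \<gamma> = \<gamma> and \<beta> = \<beta> and a = a and r = r and k = m])
         (auto simp: K_def \<alpha>_def holomorphic_embedding_def)
    then show ?thesis
      using moment_map_monotone_along_orbit(2)[OF M T assms(3,5) q, of v s] by (simp add: \<Phi>)
  qed
  have F1_in: "legendre F1 s \<in> rel_interior P" for s
    unfolding P_def by (rule gradient_in_rel_interior[OF K F1_deriv mono strict bounded])
  have aff: "rel_interior P \<subseteq> affine hull (\<alpha> ` K)"
    using rel_interior_subset[of P] convex_hull_subset_affine_hull[of "\<alpha> ` K"] unfolding P_def by blast
  have "y \<in> range (legendre F1)" if "y \<in> rel_interior P" for y
    by (rule rel_interior_subset_gradient_image[OF K F1_deriv _ bounded])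
       (use F1_in aff that in \<open>auto simp: P_def\<close>)
  then have "range (legendre F1) = rel_interior P" using F1_in by auto
  moreover have "y \<in> range (legendre F)" if "y \<in> rel_interior P" for y
    by (rule rel_interior_subset_gradient_image[OF K F_deriv(2), where B = 0])
       (use F_deriv(1) aff that in \<open>auto simp: P_def F\<close>)
  then have "range (legendre F) = rel_interior P" using F_deriv(1) by auto
  moreover have "\<Phi> ` orbit act q = range (legendre F1)"
    by (rule moment_image_eq_range_legendre[OF assms(18)])
  moreover have "\<Psi> ` orbit (cp_action \<beta>) p = range (legendre F)"
    by (rule moment_image_eq_range_legendre[OF assms(17)])
  moreover have "polytope P" unfolding P_def by (intro polytope_convex_hull finite_imageI K(1))
  ultimately show ?thesis by metis
qed

end
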